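(* Let $a\in(0,\infty)$, $\beta\in(0,1)$, $1<p<q<\infty$ and $1/q=1/p-\beta$. Then both $I_a^\beta$ and $\widetilde I_a^\beta$ are bounded from $L^p(\gamma)$ to $L^q(\gamma)$ and from $L^1(\gamma)$ to $L^{1/(1-\beta),\,\infty}(\gamma)$.
   Context: Fix $n\in\{1,2,\dots\}$. Let $d\gamma(x)=\pi^{-n/2}e^{-|x|^2}dx$ be the Gauss measure on $\mathbb R^n$, where $|\cdot|$ is the Euclidean norm. $B(x,r)=\{y\in\mathbb R^n:|x-y|<r\}$, $m(x)=\min\{1,1/|x|\}$ (with $m(0)=1$), and $V(x,y)=\gamma(B(x,|x-y|))$. For $a\in(0,\infty)$, $\beta\in(0,1)$, the local fractional integral operators are $$I_a^\beta(f)(x)=\int_{B(x,\,am(x))}\frac{f(y)}{[V(x,y)]^{1-\beta}}\,d\gamma(y),\qquad \widetilde I_a^\beta(f)(x)=\int_{B(x,\,am(x))}\frac{f(y)}{[e^{-|x|^2}|x-y|^n]^{1-\beta}}\,d\gamma(y),$$ the same formulas being used for every $f$ in the space on which the operator is considered. $L^{r,\infty}(\gamma)$ is the weak Lebesgue space, with quasi-norm $\sup_{\lambda>0}\lambda\,[\gamma(\{x:|g(x)|>\lambda\})]^{1/r}$. An operator $T$ is bounded from a (quasi-)normed space $\mathcal X$ to a (quasi-)normed space $\mathcal Y$ if there is a constant $C\ge0$ with $\|T(f)\|_{\mathcal Y}\le C\|f\|_{\mathcal X}$ for all $f\in\mathcal X$. *)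

theory Defs
  imports "HOL-Analysis.Analysis"
begin

definition gauss :: "(real ^ 'n) measure" where
  "gauss = density lborel
     (\<lambda>x. ennreal (pi powr (- (real CARD('n) / 2)) * exp (- (norm x)\<^sup>2)))"

(* The case distinction is needed because 1 / 0 = 0. *)
definition adm :: "real ^ 'n \<Rightarrow> real" where
  "adm x = (if x = 0 then 1 else min 1 (1 / norm x))"

definition gvol :: "real ^ 'n \<Rightarrow> real ^ 'n \<Rightarrow> real" where
  "gvol x y = measure gauss (ball x (norm (x - y)))"

(* Functions take values in a type of sort {real_normed_field, euclidean_space}, that is, in the
   real or the complex numbers. On the null set y = x the two integrands below are 0,
   because 0 powr s = 0 and z / 0 = 0. *)

definition frac_integrand ::
  "real \<Rightarrow> (real ^ 'n \<Rightarrow> 'k) \<Rightarrow> real ^ 'n \<Rightarrow> real ^ 'n \<Rightarrow> 'k::{real_normed_field, euclidean_space}" where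
  "frac_integrand \<beta> f x y = f y / of_real (gvol x y powr (1 - \<beta>))"

definition frac_integrand_tilde ::
  "real \<Rightarrow> (real ^ 'n \<Rightarrow> 'k) \<Rightarrow> real ^ 'n \<Rightarrow> real ^ 'n \<Rightarrow> 'k::{real_normed_field, euclidean_space}" where
  "frac_integrand_tilde \<beta> f x y =
     f y / of_real ((exp (- (norm x)\<^sup>2) * norm (x - y) ^ CARD('n)) powr (1 - \<beta>))"

(* The Bochner integral is 0 for a non-integrable integrand, so absolute convergence of the
   integrals defining the operators is recorded separately by the two predicates frac_defined
   and frac_defined_tilde. *)

definition frac_int ::
  "real \<Rightarrow> real \<Rightarrow> (real ^ 'n \<Rightarrow> 'k) \<Rightarrow> real ^ 'n \<Rightarrow> 'k::{real_normed_field, euclidean_space}" where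
  "frac_int a \<beta> f x = (LINT y:ball x (a * adm x)|gauss. frac_integrand \<beta> f x y)"

definition frac_defined ::
  "real \<Rightarrow> real \<Rightarrow> (real ^ 'n \<Rightarrow> 'k::{real_normed_field, euclidean_space}) \<Rightarrow> real ^ 'n \<Rightarrow> bool" where
  "frac_defined a \<beta> f x \<longleftrightarrow> set_integrable gauss (ball x (a * adm x)) (frac_integrand \<beta> f x)"

definition frac_int_tilde ::
  "real \<Rightarrow> real \<Rightarrow> (real ^ 'n \<Rightarrow> 'k) \<Rightarrow> real ^ 'n \<Rightarrow> 'k::{real_normed_field, euclidean_space}" where
  "frac_int_tilde a \<beta> f x = (LINT y:ball x (a * adm x)|gauss. frac_integrand_tilde \<beta> f x y)"

definition frac_defined_tilde ::
  "real \<Rightarrow> real \<Rightarrow> (real ^ 'n \<Rightarrow> 'k::{real_normed_field, euclidean_space}) \<Rightarrow> real ^ 'n \<Rightarrow> bool" where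
  "frac_defined_tilde a \<beta> f x \<longleftrightarrow>
     set_integrable gauss (ball x (a * adm x)) (frac_integrand_tilde \<beta> f x)"

(* Spaces consist of functions rather than of classes modulo null sets; the operators above
   do not distinguish functions that agree almost everywhere. *)

definition Lp :: "real \<Rightarrow> (real ^ 'n \<Rightarrow> 'k::{real_normed_field, euclidean_space}) set" where
  "Lp r = {f \<in> borel_measurable gauss. integrable gauss (\<lambda>x. norm (f x) powr r)}"

definition Lp_norm :: "real \<Rightarrow> (real ^ 'n \<Rightarrow> 'k::{real_normed_field, euclidean_space}) \<Rightarrow> real" where
  "Lp_norm r f = (LINT x|gauss. norm (f x) powr r) powr (1 / r)"

definition weak_Lp :: "real \<Rightarrow> (real ^ 'n \<Rightarrow> 'k::{real_normed_field, euclidean_space}) set" where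
  "weak_Lp r = {g \<in> borel_measurable gauss.
     bdd_above ((\<lambda>l. l * measure gauss {x. l < norm (g x)} powr (1 / r)) ` {0<..})}"

definition weak_Lp_norm :: "real \<Rightarrow> (real ^ 'n \<Rightarrow> 'k::{real_normed_field, euclidean_space}) \<Rightarrow> real" where
  "weak_Lp_norm r g = (SUP l\<in>{0<..}. l * measure gauss {x. l < norm (g x)} powr (1 / r))"

(* D f x says that the operator T is genuinely defined for f at the point x. *)
definition bounded_operator ::
  "((real ^ 'n \<Rightarrow> 'k) \<Rightarrow> real ^ 'n \<Rightarrow> bool) \<Rightarrow> ((real ^ 'n \<Rightarrow> 'k) \<Rightarrow> real ^ 'n \<Rightarrow> 'k) \<Rightarrow>
   (real ^ 'n \<Rightarrow> 'k) set \<Rightarrow> ((real ^ 'n \<Rightarrow> 'k) \<Rightarrow> real) \<Rightarrow>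
   (real ^ 'n \<Rightarrow> 'k) set \<Rightarrow> ((real ^ 'n \<Rightarrow> 'k::{real_normed_field, euclidean_space}) \<Rightarrow> real) \<Rightarrow> bool" where
  "bounded_operator D T X normX Y normY \<longleftrightarrow>
     (\<forall>f\<in>X. AE x in gauss. D f x) \<and>
     (\<exists>C\<ge>0. \<forall>f\<in>X. T f \<in> Y \<and> normY (T f) \<le> C * normX f)"

end

theory Submission
  imports Defs "HOL-Probability.Distributions"
begin

text \<open>
  The theorem is a Hardy--Littlewood--Sobolev inequality, and it holds for a reason that no longer
  sees the Gauss measure: the kernels of both operators lie in weak \<open>L\<^sup>r\<close> with \<open>r = 1 / (1 - \<beta>)\<close>, uniformly
  in each of the two variables, and such kernels map \<open>L\<^sup>p\<close> to \<open>L\<^sup>q\<close> and \<open>L\<^sup>1\<close> to weak \<open>L\<^sup>r\<close> on every finite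
  measure space.

  For the kernels: on a ball of radius \<open>a * adm x\<close> around \<open>x\<close> the Gaussian density is constant up to a
  factor (\<open>exp_norm_sq_comparable\<close>). Hence the Gauss volume of \<open>ball x (dist x y)\<close> is at least a multiple of
  \<open>exp (- (norm x)\<^sup>2) * dist x y ^ CARD('n)\<close>, and the set of all \<open>y\<close>, or of all \<open>x\<close>, where the kernel
  exceeds \<open>t\<close> is contained in a ball of Gauss measure at most a multiple of \<open>t powr (- r)\<close>
  (\<open>weak_kernel_local\<close>).

  For the operators: weak \<open>L\<^sup>r\<close> bounds imply that the integral of the kernel over a set \<open>E\<close>, in either
  variable, is at most a constant times the measure of \<open>E\<close> to the power \<open>\<beta>\<close> (\<open>weak_Lp_set_test\<close>).
  Testing the potential of \<open>f\<close> on its own level sets gives the weak type estimate (\<open>weak_type\<close>). For the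
  strong type estimate (\<open>strong_type_bounded\<close>) the integral of the \<open>q\<close>-th power of the potential is
  written as a double integral, and the pairs \<open>(x, y)\<close> are split by comparing \<open>f y\<close> with a power of
  the potential at \<open>x\<close>. On either part one of the two functions is cut at a height given by the other one,
  and the set test together with Chebyshev's inequality integrates the function that is cut
  (\<open>nn_integral_small_values\<close>). The relation \<open>1 / q = 1 / p - \<beta>\<close> makes the exponents match.
\<close>

section \<open>Integration by level sets\<close>

text \<open>
  With \<open>S\<close> a half line above \<open>T\<close> the left integrand contains the excess of \<open>g\<close> over \<open>T\<close>;
  with \<open>S\<close> the interval from \<open>0\<close> to \<open>\<tau>\<close> it contains the truncation of \<open>g\<close> at \<open>\<tau>\<close>. In both cases
  bounds for the super-level sets of \<open>g\<close> turn into integrals of a power of \<open>s\<close>.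
\<close>

lemma nn_integral_layer_cake:
  fixes g :: "'a \<Rightarrow> real"
  assumes "sigma_finite_measure M"
    and w [measurable]: "w \<in> borel_measurable M" and g [measurable]: "g \<in> borel_measurable M"
    and S [measurable]: "S \<in> sets borel"
  shows "(\<integral>\<^sup>+ y. w y * emeasure lborel (S \<inter> {..<g y}) \<partial>M) =
         (\<integral>\<^sup>+ s. indicator S s * (\<integral>\<^sup>+ y. w y * indicator {y. s < g y} y \<partial>M) \<partial>lborel)"
proof -
  interpret M: sigma_finite_measure M by fact
  interpret pair_sigma_finite M lborel ..
  have "(\<integral>\<^sup>+ y. w y * emeasure lborel (S \<inter> {..<g y}) \<partial>M) =
      (\<integral>\<^sup>+ y. \<integral>\<^sup>+ s. w y * (indicator S s * indicator {y. s < g y} y) \<partial>lborel \<partial>M)"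
  proof (rule nn_integral_cong)
    fix y
    have "emeasure lborel (S \<inter> {..<g y}) = (\<integral>\<^sup>+ s. indicator (S \<inter> {..<g y}) s \<partial>lborel)"
      by (subst nn_integral_indicator) auto
    also have "\<dots> = (\<integral>\<^sup>+ s. indicator S s * indicator {y. s < g y} y \<partial>lborel)"
      by (intro nn_integral_cong) (auto simp: indicator_def)
    finally show "w y * emeasure lborel (S \<inter> {..<g y}) =
        (\<integral>\<^sup>+ s. w y * (indicator S s * indicator {y. s < g y} y) \<partial>lborel)"
      by (simp add: nn_integral_cmult)
  qed
  also have "\<dots> = (\<integral>\<^sup>+ s. \<integral>\<^sup>+ y. w y * (indicator S s * indicator {y. s < g y} y) \<partial>M \<partial>lborel)"
    by (rule Fubini'[symmetric]) measurable
  also have "\<dots> = (\<integral>\<^sup>+ s. indicator S s * (\<integral>\<^sup>+ y. w y * indicator {y. s < g y} y \<partial>M) \<partial>lborel)"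
    by (subst nn_integral_cmult[symmetric]) (auto intro!: nn_integral_cong simp: mult_ac)
  finally show ?thesis .
qed

lemma nn_integral_powr_above:
  fixes T e :: real
  assumes "e < -1" "0 < T"
  shows "(\<integral>\<^sup>+ s. indicator {T<..} s * ennreal (s powr e) \<partial>lborel) \<le> ennreal (T powr (e + 1) / (- e - 1))"
proof -
  have "(\<integral>\<^sup>+ s. indicator {T<..} s * ennreal (s powr e) \<partial>lborel)
      \<le> (\<integral>\<^sup>+ s. ennreal (s powr e) * indicator {T..} s \<partial>lborel)"
    by (intro nn_integral_mono) (auto simp: indicator_def)
  also have "\<dots> = ennreal (-(T powr (e+1)) / (e+1))"
    using has_integral_powr_to_inf[OF assms] by (intro nn_integral_has_integral_lebesgue') auto
  also have "-(T powr (e+1)) / (e+1) = T powr (e + 1) / (- e - 1)"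
    using assms by (simp add: field_simps)
  finally show ?thesis .
qed

lemma nn_integral_powr_below:
  fixes T e :: real
  assumes "-1 < e" "0 \<le> T"
  shows "(\<integral>\<^sup>+ s. indicator {0<..T} s * ennreal (s powr e) \<partial>lborel) \<le> ennreal (T powr (e + 1) / (e + 1))"
proof -
  have "(\<integral>\<^sup>+ s. indicator {0<..T} s * ennreal (s powr e) \<partial>lborel)
      \<le> (\<integral>\<^sup>+ s. ennreal (s powr e) * indicator {0..T} s \<partial>lborel)"
    by (intro nn_integral_mono) (auto simp: indicator_def)
  also have "\<dots> = ennreal (T powr (e+1) / (e+1))"
    using has_integral_powr_from_0[OF assms] by (intro nn_integral_has_integral_lebesgue') auto
  finally show ?thesis .
qed

context finite_measure
begin

text \<open>
  A function in weak \<open>L\<^sup>r\<close> with \<open>r > 1\<close> can be integrated over a set \<open>E\<close> by cutting it at one level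
  \<open>T\<close>: below \<open>T\<close> it contributes at most \<open>T\<close> times the measure of \<open>E\<close>, above \<open>T\<close> at most a multiple
  of \<open>T\<close> to the power \<open>1 - r\<close>.
\<close>

lemma weak_Lp_set_test:
  fixes k :: "'a \<Rightarrow> real"
  assumes k [measurable]: "k \<in> borel_measurable M"
    and r: "1 < r"
    and tail: "\<And>t. 0 < t \<Longrightarrow> measure M {y \<in> space M. t < k y} \<le> A * t powr (- r)"
    and E [measurable]: "E \<in> sets M"
  shows "(\<integral>\<^sup>+ y. ennreal (k y) * indicator E y \<partial>M) \<le> ennreal ((1 + A / (r - 1)) * measure M E powr (1 - 1 / r))"
proof (cases "measure M E = 0")
  case True
  then have "E \<in> null_sets M"
    by (auto simp: emeasure_eq_measure)
  then have "(\<integral>\<^sup>+ y. ennreal (k y) * indicator E y \<partial>M) = 0"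
    by (rule nn_integral_null_set)
  then show ?thesis by simp
next
  case False
  then have m: "0 < measure M E"
    using measure_nonneg[of M E] by linarith
  \<comment> \<open>This level makes both contributions multiples of the same power of the measure of \<open>E\<close>.\<close>
  define T where "T = measure M E powr (- 1 / r)"
  have T: "0 < T"
    using m by (simp add: T_def)
  have A: "0 \<le> A"
    using order_trans[OF measure_nonneg tail[of 1]] by simp
  have above: "(\<integral>\<^sup>+ y. ennreal (k y - T) \<partial>M) \<le> ennreal (A * (T powr (1 - r) / (r - 1)))"
  proof -
    have "emeasure lborel ({T<..} \<inter> {..<k y}) = ennreal (k y - T)" for y
    proof -
      have "{T<..} \<inter> {..<k y} = {T<..<k y}" by auto
      then show ?thesis
        by (cases "T \<le> k y") (auto simp: ennreal_neg)
    qed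
    then have "(\<integral>\<^sup>+ y. ennreal (k y - T) \<partial>M) = (\<integral>\<^sup>+ y. 1 * emeasure lborel ({T<..} \<inter> {..<k y}) \<partial>M)"
      by simp
    also have "\<dots> = (\<integral>\<^sup>+ s. indicator {T<..} s * (\<integral>\<^sup>+ y. 1 * indicator {y. s < k y} y \<partial>M) \<partial>lborel)"
      by (rule nn_integral_layer_cake) (auto intro: sigma_finite_measure_axioms)
    also have "\<dots> \<le> (\<integral>\<^sup>+ s. ennreal A * (indicator {T<..} s * ennreal (s powr (- r))) \<partial>lborel)"
    proof (rule nn_integral_mono)
      fix s
      show "indicator {T<..} s * (\<integral>\<^sup>+ y. 1 * indicator {y. s < k y} y \<partial>M)
          \<le> ennreal A * (indicator {T<..} s * ennreal (s powr (- r)))"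
      proof (cases "T < s")
        case True
        have "(\<integral>\<^sup>+ y. 1 * indicator {y. s < k y} y \<partial>M) = (\<integral>\<^sup>+ y. indicator {y \<in> space M. s < k y} y \<partial>M)"
          by (intro nn_integral_cong) (auto simp: indicator_def)
        also have "\<dots> = ennreal (measure M {y \<in> space M. s < k y})"
          by (subst nn_integral_indicator) (auto simp: emeasure_eq_measure)
        also have "\<dots> \<le> ennreal (A * s powr (- r))"
          using True T by (intro ennreal_leI tail) auto
        finally show ?thesis
          using True A by (simp add: ennreal_mult)
      qed simp
    qed
    also have "\<dots> = ennreal A * (\<integral>\<^sup>+ s. indicator {T<..} s * ennreal (s powr (- r)) \<partial>lborel)"
      by (rule nn_integral_cmult) measurable
    also have "\<dots> \<le> ennreal A * ennreal (T powr (- r + 1) / (- (- r) - 1))"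
      using r T by (intro mult_left_mono nn_integral_powr_above) auto
    also have "\<dots> = ennreal (A * (T powr (1 - r) / (r - 1)))"
      using A r by (subst ennreal_mult[symmetric]) (auto simp: add.commute)
    finally show ?thesis .
  qed
  have "(\<integral>\<^sup>+ y. ennreal (k y) * indicator E y \<partial>M)
      \<le> (\<integral>\<^sup>+ y. ennreal T * indicator E y + ennreal (k y - T) \<partial>M)"
  proof (rule nn_integral_mono)
    fix y
    show "ennreal (k y) * indicator E y \<le> ennreal T * indicator E y + ennreal (k y - T)"
      using T by (cases "T \<le> k y") (auto simp: indicator_def ennreal_plus[symmetric] ennreal_neg
          intro!: ennreal_leI simp del: ennreal_plus)
  qed
  also have "\<dots> = ennreal T * emeasure M E + (\<integral>\<^sup>+ y. ennreal (k y - T) \<partial>M)"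
    by (subst nn_integral_add) (auto simp: nn_integral_cmult_indicator)
  also have "\<dots> \<le> ennreal T * ennreal (measure M E) + ennreal (A * (T powr (1 - r) / (r - 1)))"
    by (intro add_mono above) (simp add: emeasure_eq_measure)
  also have "\<dots> = ennreal (T * measure M E + A * (T powr (1 - r) / (r - 1)))"
    using T A r by (simp add: ennreal_mult[symmetric] ennreal_plus[symmetric] del: ennreal_plus)
  also have "T * measure M E + A * (T powr (1 - r) / (r - 1)) = (1 + A / (r - 1)) * measure M E powr (1 - 1 / r)"
  proof -
    have "T * measure M E = measure M E powr (1 - 1 / r)"
      using m by (simp add: T_def powr_diff powr_minus field_simps)
    moreover have "T powr (1 - r) = measure M E powr (1 - 1 / r)"
    proof -
      have "(- 1 / r) * (1 - r) = 1 - 1 / r"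
        using r by (simp add: field_simps)
      then show ?thesis
        by (simp only: T_def powr_powr)
    qed
    ultimately show ?thesis
      by (simp add: algebra_simps)
  qed
  finally show ?thesis .
qed

text \<open>
  If the measure with density \<open>k\<close> is controlled by the power \<open>\<beta>\<close> of \<open>M\<close>, then the weak \<open>L\<^sup>r\<close> bound
  for \<open>g\<close> with respect to \<open>M\<close> becomes a tail of order \<open>r * \<beta>\<close> with respect to that density. This tail
  is integrable at \<open>0\<close>, and so the part of \<open>g\<close> below the height \<open>\<tau>\<close> has the stated integral.
\<close>

lemma nn_integral_small_values:
  fixes k :: "'a \<Rightarrow> ennreal" and g :: "'a \<Rightarrow> real"
  assumes k [measurable]: "k \<in> borel_measurable M"
    and g [measurable]: "g \<in> borel_measurable M" and nonneg: "\<And>y. 0 \<le> g y"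
    and test: "\<And>E. E \<in> sets M \<Longrightarrow> (\<integral>\<^sup>+ y. k y * indicator E y \<partial>M) \<le> ennreal (B * measure M E powr \<beta>)"
    and tail: "\<And>s. 0 < s \<Longrightarrow> measure M {y \<in> space M. s < g y} \<le> D * s powr (- r)"
    and "0 \<le> B" "0 \<le> D" "0 \<le> \<beta>" "r * \<beta> < 1" "0 \<le> \<tau>"
  shows "(\<integral>\<^sup>+ y. k y * (ennreal (g y) * indicator {y. g y \<le> \<tau>} y) \<partial>M)
      \<le> ennreal (B * D powr \<beta> / (1 - r * \<beta>) * \<tau> powr (1 - r * \<beta>))"
proof -
  have "(\<integral>\<^sup>+ y. k y * (ennreal (g y) * indicator {y. g y \<le> \<tau>} y) \<partial>M)
      \<le> (\<integral>\<^sup>+ y. k y * emeasure lborel ({0<..\<tau>} \<inter> {..<g y}) \<partial>M)"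
  proof (intro nn_integral_mono mult_left_mono)
    fix y
    show "ennreal (g y) * indicator {y. g y \<le> \<tau>} y \<le> emeasure lborel ({0<..\<tau>} \<inter> {..<g y})"
    proof (cases "g y \<le> \<tau>")
      case True
      then have "{0<..\<tau>} \<inter> {..<g y} = {0<..<g y}" by auto
      then show ?thesis using True nonneg[of y] by simp
    qed simp
  qed simp
  also have "\<dots> = (\<integral>\<^sup>+ s. indicator {0<..\<tau>} s * (\<integral>\<^sup>+ y. k y * indicator {y. s < g y} y \<partial>M) \<partial>lborel)"
    by (rule nn_integral_layer_cake) (auto intro: sigma_finite_measure_axioms)
  also have "\<dots> \<le> (\<integral>\<^sup>+ s. ennreal (B * D powr \<beta>) * (indicator {0<..\<tau>} s * ennreal (s powr (- r * \<beta>))) \<partial>lborel)"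
  proof (rule nn_integral_mono)
    fix s
    show "indicator {0<..\<tau>} s * (\<integral>\<^sup>+ y. k y * indicator {y. s < g y} y \<partial>M)
        \<le> ennreal (B * D powr \<beta>) * (indicator {0<..\<tau>} s * ennreal (s powr (- r * \<beta>)))"
    proof (cases "s \<in> {0<..\<tau>}")
      case True
      have "(\<integral>\<^sup>+ y. k y * indicator {y. s < g y} y \<partial>M) = (\<integral>\<^sup>+ y. k y * indicator {y \<in> space M. s < g y} y \<partial>M)"
        by (intro nn_integral_cong) (auto simp: indicator_def)
      also have "\<dots> \<le> ennreal (B * measure M {y \<in> space M. s < g y} powr \<beta>)"
        by (rule test) measurable
      also have "\<dots> \<le> ennreal (B * (D * s powr (- r)) powr \<beta>)"
        using True assms by (intro ennreal_leI mult_left_mono powr_mono2 tail) auto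
      also have "B * (D * s powr (- r)) powr \<beta> = B * D powr \<beta> * s powr (- r * \<beta>)"
        using assms by (simp add: powr_mult powr_powr)
      finally show ?thesis
        using True assms by (simp add: ennreal_mult)
    qed (auto simp: indicator_def)
  qed
  also have "\<dots> = ennreal (B * D powr \<beta>) * (\<integral>\<^sup>+ s. indicator {0<..\<tau>} s * ennreal (s powr (- r * \<beta>)) \<partial>lborel)"
    by (rule nn_integral_cmult) measurable
  also have "\<dots> \<le> ennreal (B * D powr \<beta>) * ennreal (\<tau> powr (- r * \<beta> + 1) / (- r * \<beta> + 1))"
    using assms by (intro mult_left_mono nn_integral_powr_below) auto
  also have "\<dots> = ennreal (B * D powr \<beta> / (1 - r * \<beta>) * \<tau> powr (1 - r * \<beta>))"
    using assms by (subst ennreal_mult[symmetric]) (auto simp: add.commute)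
  finally show ?thesis .
qed

end

section \<open>Potentials of kernels in weak Lebesgue spaces\<close>

lemma (in finite_measure) Chebyshev_powr:
  fixes f :: "'a \<Rightarrow> real"
  assumes f [measurable]: "f \<in> borel_measurable M" and nonneg: "\<And>x. 0 \<le> f x"
    and int: "integrable M (\<lambda>x. f x powr p)" and "0 < p" "0 < s"
  shows "measure M {x \<in> space M. s < f x} \<le> (\<integral>x. f x powr p \<partial>M) * s powr (- p)"
proof -
  have "measure M {x \<in> space M. s < f x} * s powr p = (\<integral>x. s powr p * indicator {x \<in> space M. s < f x} x \<partial>M)"
    by (simp add: Int_def conj_ac)
  also have "\<dots> \<le> (\<integral>x. f x powr p \<partial>M)"
  proof (rule integral_mono)
    show "integrable M (\<lambda>x. s powr p * indicator {x \<in> space M. s < f x} x)"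
      by (intro integrable_mult_right integrable_real_indicator) (auto simp: less_top[symmetric])
  next
    fix x
    show "s powr p * indicator {x \<in> space M. s < f x} x \<le> f x powr p"
      using assms by (auto simp: indicator_def intro!: powr_mono2)
  qed (rule int)
  finally show ?thesis
    using \<open>0 < s\<close> by (simp add: powr_minus field_simps)
qed

text \<open>
  With \<open>r = 1 / (1 - \<beta>)\<close>, all rows and all columns of the kernel lie in a fixed ball of weak \<open>L\<^sup>r\<close>.
  This is the integrability of the Riesz kernel of order \<open>n * \<beta>\<close> in dimension \<open>n\<close>.
\<close>

locale weak_kernel = finite_measure M for M :: "'a measure" +
  fixes K :: "'a \<Rightarrow> 'a \<Rightarrow> real" and A \<beta> :: real
  assumes K_measurable [measurable]: "(\<lambda>(x, y). K x y) \<in> borel_measurable (M \<Otimes>\<^sub>M M)"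
    and K_nonneg: "\<And>x y. 0 \<le> K x y"
    and beta: "0 < \<beta>" "\<beta> < 1"
    and row_tail: "\<And>x t. x \<in> space M \<Longrightarrow> 0 < t \<Longrightarrow>
          measure M {y \<in> space M. t < K x y} \<le> A * t powr (- (1 / (1 - \<beta>)))"
    and col_tail: "\<And>y t. y \<in> space M \<Longrightarrow> 0 < t \<Longrightarrow>
          measure M {x \<in> space M. t < K x y} \<le> A * t powr (- (1 / (1 - \<beta>)))"
begin

text \<open>
  The absolute value makes the bound positive in every case; if the space is not empty, then \<open>A\<close> is
  nonnegative anyway.
\<close>

definition test_bound :: real where
  "test_bound = 1 + \<bar>A\<bar> / (1 / (1 - \<beta>) - 1)"

lemma test_bound_pos: "0 < test_bound"
proof -
  have "0 < 1 / (1 - \<beta>) - 1"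
    using beta by (simp add: field_simps)
  then show ?thesis
    by (simp add: test_bound_def add_pos_nonneg)
qed

lemma set_test:
  fixes k :: "'a \<Rightarrow> real"
  assumes k: "k \<in> borel_measurable M"
    and tail: "\<And>t. 0 < t \<Longrightarrow> measure M {y \<in> space M. t < k y} \<le> A * t powr (- (1 / (1 - \<beta>)))"
    and E: "E \<in> sets M"
  shows "(\<integral>\<^sup>+ y. ennreal (k y) * indicator E y \<partial>M) \<le> ennreal (test_bound * measure M E powr \<beta>)"
proof -
  have "1 < 1 / (1 - \<beta>)"
    using beta by (simp add: field_simps)
  from weak_Lp_set_test[OF k this tail E]
  have *: "(\<integral>\<^sup>+ y. ennreal (k y) * indicator E y \<partial>M)
      \<le> ennreal ((1 + A / (1 / (1 - \<beta>) - 1)) * measure M E powr (1 - 1 / (1 / (1 - \<beta>))))"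
    by simp
  have "0 \<le> A"
    using order_trans[OF measure_nonneg tail[of 1]] by simp
  then show ?thesis
    using * by (simp add: test_bound_def)
qed

lemma row_test:
  assumes "x \<in> space M" "E \<in> sets M"
  shows "(\<integral>\<^sup>+ y. ennreal (K x y) * indicator E y \<partial>M) \<le> ennreal (test_bound * measure M E powr \<beta>)"
  using assms by (intro set_test row_tail) auto

lemma col_test:
  assumes "y \<in> space M" "E \<in> sets M"
  shows "(\<integral>\<^sup>+ x. ennreal (K x y) * indicator E x \<partial>M) \<le> ennreal (test_bound * measure M E powr \<beta>)"
  using assms by (intro set_test col_tail) auto

text \<open>
  By Tonelli's theorem the kernel is first integrated over \<open>E\<close> in its first variable, where the set
  test applies uniformly in the second one.
\<close>

lemma potential_set_bound:
  fixes f :: "'a \<Rightarrow> real"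
  assumes int: "integrable M f" and nonneg: "\<And>y. 0 \<le> f y" and E [measurable]: "E \<in> sets M"
  shows "(\<integral>\<^sup>+ x. (\<integral>\<^sup>+ y. ennreal (K x y * f y) \<partial>M) * indicator E x \<partial>M)
      \<le> ennreal (test_bound * measure M E powr \<beta> * (\<integral>y. f y \<partial>M))"
proof -
  interpret P: pair_sigma_finite M M ..
  have f [measurable]: "f \<in> borel_measurable M"
    using int by auto
  have "(\<integral>\<^sup>+ x. (\<integral>\<^sup>+ y. ennreal (K x y * f y) \<partial>M) * indicator E x \<partial>M)
      = (\<integral>\<^sup>+ x. \<integral>\<^sup>+ y. ennreal (f y) * (ennreal (K x y) * indicator E x) \<partial>M \<partial>M)"
    using nonneg K_nonneg
    by (intro nn_integral_cong) (simp add: ennreal_mult indicator_def mult.commute)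
  also have "\<dots> = (\<integral>\<^sup>+ y. \<integral>\<^sup>+ x. ennreal (f y) * (ennreal (K x y) * indicator E x) \<partial>M \<partial>M)"
    by (rule P.Fubini') measurable
  also have "\<dots> = (\<integral>\<^sup>+ y. ennreal (f y) * (\<integral>\<^sup>+ x. ennreal (K x y) * indicator E x \<partial>M) \<partial>M)"
    by (intro nn_integral_cong nn_integral_cmult) auto
  also have "\<dots> \<le> (\<integral>\<^sup>+ y. ennreal (f y) * ennreal (test_bound * measure M E powr \<beta>) \<partial>M)"
    by (intro nn_integral_mono mult_left_mono col_test) auto
  also have "\<dots> = (\<integral>\<^sup>+ y. ennreal (f y) \<partial>M) * ennreal (test_bound * measure M E powr \<beta>)"
    by (rule nn_integral_multc) measurable
  also have "(\<integral>\<^sup>+ y. ennreal (f y) \<partial>M) = ennreal (\<integral>y. f y \<partial>M)"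
    using nonneg by (intro nn_integral_eq_integral int) auto
  also have "ennreal (\<integral>y. f y \<partial>M) * ennreal (test_bound * measure M E powr \<beta>)
      = ennreal (test_bound * measure M E powr \<beta> * (\<integral>y. f y \<partial>M))"
    using nonneg test_bound_pos by (subst ennreal_mult[symmetric]) (auto simp: mult_ac)
  finally show ?thesis .
qed

lemma potential_finite_AE:
  fixes f :: "'a \<Rightarrow> real"
  assumes int: "integrable M f" and nonneg: "\<And>y. 0 \<le> f y"
  shows "AE x in M. (\<integral>\<^sup>+ y. ennreal (K x y * f y) \<partial>M) < \<infinity>"
proof -
  have [measurable]: "f \<in> borel_measurable M"
    using int by auto
  have "(\<integral>\<^sup>+ x. (\<integral>\<^sup>+ y. ennreal (K x y * f y) \<partial>M) \<partial>M)
      = (\<integral>\<^sup>+ x. (\<integral>\<^sup>+ y. ennreal (K x y * f y) \<partial>M) * indicator (space M) x \<partial>M)"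
    by (intro nn_integral_cong) simp
  also have "\<dots> \<le> ennreal (test_bound * measure M (space M) powr \<beta> * (\<integral>y. f y \<partial>M))"
    by (intro potential_set_bound assms) auto
  finally have "(\<integral>\<^sup>+ x. (\<integral>\<^sup>+ y. ennreal (K x y * f y) \<partial>M) \<partial>M) \<noteq> \<infinity>"
    by (auto simp: top_unique)
  then have "AE x in M. (\<integral>\<^sup>+ y. ennreal (K x y * f y) \<partial>M) \<noteq> \<infinity>"
    by (intro nn_integral_PInf_AE) auto
  then show ?thesis
    by (simp add: less_top)
qed

text \<open>
  The level set \<open>E\<close> itself is used as a test set: \<open>l\<close> times its measure is at most the integral of
  the potential over \<open>E\<close>, hence at most a constant times its measure to the power \<open>\<beta>\<close>; one divides by
  that power. A function \<open>g\<close> dominated by the potential takes the place of the potential, which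
  may be infinite.
\<close>

lemma weak_type:
  fixes f g :: "'a \<Rightarrow> real"
  assumes int: "integrable M f" and nonneg: "\<And>y. 0 \<le> f y"
    and g [measurable]: "g \<in> borel_measurable M"
    and dom: "\<And>x. x \<in> space M \<Longrightarrow> ennreal (g x) \<le> (\<integral>\<^sup>+ y. ennreal (K x y * f y) \<partial>M)"
    and l: "0 < l"
  shows "l * measure M {x \<in> space M. l < g x} powr (1 - \<beta>) \<le> test_bound * (\<integral>y. f y \<partial>M)"
proof -
  define E where "E = {x \<in> space M. l < g x}"
  have E [measurable]: "E \<in> sets M"
    by (simp add: E_def)
  have f0: "0 \<le> (\<integral>y. f y \<partial>M)"
    using nonneg by simp
  have "ennreal (l * measure M E) = (\<integral>\<^sup>+ x. ennreal l * indicator E x \<partial>M)"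
    using l by (simp add: nn_integral_cmult_indicator emeasure_eq_measure ennreal_mult)
  also have "\<dots> \<le> (\<integral>\<^sup>+ x. (\<integral>\<^sup>+ y. ennreal (K x y * f y) \<partial>M) * indicator E x \<partial>M)"
  proof (rule nn_integral_mono)
    fix x assume "x \<in> space M"
    then show "ennreal l * indicator E x \<le> (\<integral>\<^sup>+ y. ennreal (K x y * f y) \<partial>M) * indicator E x"
      using dom[of x] order_trans[OF ennreal_leI[of l "g x"]] by (auto simp: indicator_def E_def)
  qed
  also have "\<dots> \<le> ennreal (test_bound * measure M E powr \<beta> * (\<integral>y. f y \<partial>M))"
    by (intro potential_set_bound int nonneg E)
  finally have *: "l * measure M E \<le> test_bound * measure M E powr \<beta> * (\<integral>y. f y \<partial>M)"
    using test_bound_pos f0 by (subst (asm) ennreal_le_iff) auto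
  show ?thesis
  proof (cases "measure M E = 0")
    case True
    then show ?thesis
      using test_bound_pos f0 by (simp add: E_def)
  next
    case False
    then have m: "0 < measure M E"
      using measure_nonneg[of M E] by linarith
    have "measure M E = measure M E powr (1 - \<beta>) * measure M E powr \<beta>"
      using m by (simp add: powr_add[symmetric])
    with * have "l * measure M E powr (1 - \<beta>) * measure M E powr \<beta> \<le> test_bound * (\<integral>y. f y \<partial>M) * measure M E powr \<beta>"
      by (simp add: mult_ac)
    then show ?thesis
      using m by (simp add: E_def)
  qed
qed

text \<open>
  The core estimate. Write \<open>I\<close> for the integral of \<open>g powr q\<close> and \<open>h = g powr (q - 1)\<close>, so that \<open>I\<close>
  is at most the integral of \<open>h x * K x y * f y\<close> over all pairs. The pairs are split according
  to whether \<open>f y\<close> is at most the height \<open>\<delta> * g x powr (q / p)\<close>.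
  Where it is, the integral over \<open>y\<close> only involves small values of \<open>f\<close>, and the Chebyshev bound for
  \<open>f\<close> gives a multiple of \<open>g x\<close>; altogether a multiple of \<open>I\<close>, and \<open>\<delta>\<close> is chosen to make the
  factor \<open>1 / 2\<close>. Elsewhere \<open>h x\<close> is at most a height determined by \<open>f y\<close>, so the integral over \<open>x\<close>
  only involves small values of \<open>h\<close>, and the Chebyshev bound for \<open>h\<close> gives a multiple of
  \<open>I powr \<beta> * f y powr (p - 1)\<close>; altogether a multiple of \<open>I powr \<beta>\<close>. Therefore
  \<open>I \<le> I / 2 + d * I powr \<beta>\<close>, which bounds \<open>I\<close> because \<open>\<beta> < 1\<close>. The upper bound \<open>N\<close> for \<open>g\<close>
  makes \<open>I\<close> finite, so that \<open>I / 2\<close> can be absorbed; the constant is independent of \<open>N\<close>.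
\<close>

lemma strong_type_bounded:
  fixes p q :: real
  assumes pq: "1 < p" "p < q" "1 / q = 1 / p - \<beta>"
  obtains C where
    "\<And>(f :: 'a \<Rightarrow> real) (g :: 'a \<Rightarrow> real) N. f \<in> borel_measurable M \<Longrightarrow> (\<And>y. 0 \<le> f y) \<Longrightarrow>
      integrable M (\<lambda>y. f y powr p) \<Longrightarrow> (\<integral>y. f y powr p \<partial>M) \<le> 1 \<Longrightarrow>
      g \<in> borel_measurable M \<Longrightarrow> (\<And>x. 0 \<le> g x) \<Longrightarrow> (\<And>x. g x \<le> N) \<Longrightarrow>
      (\<And>x. x \<in> space M \<Longrightarrow> ennreal (g x) \<le> (\<integral>\<^sup>+ y. ennreal (K x y * f y) \<partial>M)) \<Longrightarrow>
      (\<integral>x. g x powr q \<partial>M) \<le> C"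
proof -
  interpret P: pair_sigma_finite M M ..
  \<comment> \<open>The exponent conjugate to \<open>q\<close>: the power \<open>q'\<close> of \<open>h\<close> is the power \<open>q\<close> of \<open>g\<close>.\<close>
  define q' where "q' = q / (q - 1)"
  have q: "1 < q" "0 < q" "0 < p" "0 < q - 1"
    using pq by auto
  have q'_pos: "0 < q'"
    using q by (simp add: q'_def)
  have beta_eq: "\<beta> = 1 / p - 1 / q"
    using pq by simp
  have pb: "1 - p * \<beta> = p / q"
    using q by (simp add: beta_eq field_simps)
  have qb: "1 - q' * \<beta> = (p - 1) * q / (p * (q - 1))"
    using q by (simp add: beta_eq q'_def field_simps)
  define c where "c = test_bound / (p / q)"
  have c: "0 < c"
    using test_bound_pos q by (simp add: c_def)
  \<comment> \<open>The constant \<open>c\<close> is what the small values of \<open>f\<close> cost when \<open>\<delta> = 1\<close>.\<close>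
  define \<delta> where "\<delta> = (1 / (2 * c)) powr (q / p)"
  have \<delta>: "0 < \<delta>"
    using c by (simp add: \<delta>_def)
  have c\<delta>: "c * \<delta> powr (p / q) = 1 / 2"
    using c q by (simp add: \<delta>_def powr_powr)
  define d where "d = test_bound / (1 - q' * \<beta>) * \<delta> powr (1 - p)"
  have qb_pos: "0 < 1 - q' * \<beta>"
    using q pq unfolding qb by simp
  have d: "0 < d"
    using test_bound_pos qb_pos \<delta> by (simp add: d_def)
  have main: "(\<integral>x. g x powr q \<partial>M) \<le> (2 * d) powr (1 / (1 - \<beta>))"
    if f [measurable]: "f \<in> borel_measurable M" and f0: "\<And>y. 0 \<le> f y"
      and fint: "integrable M (\<lambda>y. f y powr p)" and f1: "(\<integral>y. f y powr p \<partial>M) \<le> 1"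
      and g [measurable]: "g \<in> borel_measurable M" and g0: "\<And>x. 0 \<le> g x" and gN: "\<And>x. g x \<le> N"
      and dom: "\<And>x. x \<in> space M \<Longrightarrow> ennreal (g x) \<le> (\<integral>\<^sup>+ y. ennreal (K x y * f y) \<partial>M)"
    for f g :: "'a \<Rightarrow> real" and N
  proof -
    define I where "I = (\<integral>x. g x powr q \<partial>M)"
    have I0: "0 \<le> I"
      by (simp add: I_def)
    have gint: "integrable M (\<lambda>x. g x powr q)"
      by (rule integrable_const_bound[where B = "N powr q"]) (use g0 gN q in \<open>auto intro!: powr_mono2\<close>)
    define h where "h = (\<lambda>x. g x powr (q - 1))"
    have h [measurable]: "h \<in> borel_measurable M" and h0: "\<And>x. 0 \<le> h x"
      by (auto simp: h_def)
    have hq: "h x powr q' = g x powr q" for x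
      using q by (simp add: h_def powr_powr q'_def)
    have hg: "h x * g x = g x powr q" for x
      using g0[of x] by (cases "g x = 0") (auto simp: h_def powr_diff)
    \<comment> \<open>The heights at which \<open>f\<close> and \<open>h\<close> are cut; \<open>\<sigma>\<close> is \<open>\<tau>\<close> solved for \<open>h x\<close>.\<close>
    define \<tau> where "\<tau> = (\<lambda>x. \<delta> * g x powr (q / p))"
    define \<sigma> where "\<sigma> = (\<lambda>y. (f y / \<delta>) powr (p / q * (q - 1)))"
    have [measurable]: "\<tau> \<in> borel_measurable M" "\<sigma> \<in> borel_measurable M"
      by (auto simp: \<tau>_def \<sigma>_def)
    have \<tau>0: "0 \<le> \<tau> x" and \<sigma>0: "0 \<le> \<sigma> x" for x
      using \<delta> by (auto simp: \<tau>_def \<sigma>_def)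
    have split: "h x \<le> \<sigma> y" if "\<not> f y \<le> \<tau> x" for x y
    proof -
      have "g x powr (q / p) \<le> f y / \<delta>"
        using that \<delta> by (simp add: \<tau>_def field_simps)
      then have "(g x powr (q / p)) powr (p / q * (q - 1)) \<le> \<sigma> y"
        unfolding \<sigma>_def using q by (intro powr_mono2) auto
      then show ?thesis
        using q by (simp add: powr_powr h_def)
    qed
    let ?a = "\<lambda>x y. ennreal (h x) * (ennreal (K x y) * (ennreal (f y) * indicator {y. f y \<le> \<tau> x} y))"
    let ?b = "\<lambda>x y. ennreal (f y) * (ennreal (K x y) * (ennreal (h x) * indicator {x. h x \<le> \<sigma> y} x))"
    have [measurable]: "(\<lambda>(x, y). ?a x y) \<in> borel_measurable (M \<Otimes>\<^sub>M M)" "(\<lambda>(x, y). ?b x y) \<in> borel_measurable (M \<Otimes>\<^sub>M M)"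
      by (simp_all add: indicator_def)
    have "ennreal I = (\<integral>\<^sup>+ x. ennreal (g x powr q) \<partial>M)"
      unfolding I_def by (intro nn_integral_eq_integral[symmetric] gint) auto
    also have "\<dots> = (\<integral>\<^sup>+ x. ennreal (h x) * ennreal (g x) \<partial>M)"
      using h0 g0 by (simp add: hg[symmetric] ennreal_mult)
    also have "\<dots> \<le> (\<integral>\<^sup>+ x. ennreal (h x) * (\<integral>\<^sup>+ y. ennreal (K x y * f y) \<partial>M) \<partial>M)"
      by (intro nn_integral_mono mult_left_mono dom) auto
    also have "\<dots> = (\<integral>\<^sup>+ x. \<integral>\<^sup>+ y. ennreal (h x) * ennreal (K x y * f y) \<partial>M \<partial>M)"
      by (intro nn_integral_cong nn_integral_cmult[symmetric]) auto
    also have "\<dots> \<le> (\<integral>\<^sup>+ x. \<integral>\<^sup>+ y. ?a x y + ?b x y \<partial>M \<partial>M)"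
    proof (intro nn_integral_mono)
      fix x y
      show "ennreal (h x) * ennreal (K x y * f y) \<le> ?a x y + ?b x y"
        using split[of y x] K_nonneg[of x y] f0[of y]
        by (cases "f y \<le> \<tau> x") (auto simp: ennreal_mult mult_ac)
    qed
    also have "\<dots> = (\<integral>\<^sup>+ x. (\<integral>\<^sup>+ y. ?a x y \<partial>M) + (\<integral>\<^sup>+ y. ?b x y \<partial>M) \<partial>M)"
      by (intro nn_integral_cong nn_integral_add) (auto simp: indicator_def)
    also have "\<dots> = (\<integral>\<^sup>+ x. \<integral>\<^sup>+ y. ?a x y \<partial>M \<partial>M) + (\<integral>\<^sup>+ x. \<integral>\<^sup>+ y. ?b x y \<partial>M \<partial>M)"
      by (rule nn_integral_add) measurable
    also have "(\<integral>\<^sup>+ x. \<integral>\<^sup>+ y. ?b x y \<partial>M \<partial>M) = (\<integral>\<^sup>+ y. \<integral>\<^sup>+ x. ?b x y \<partial>M \<partial>M)"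
      by (rule P.Fubini') measurable
    finally have sum: "ennreal I \<le> (\<integral>\<^sup>+ x. \<integral>\<^sup>+ y. ?a x y \<partial>M \<partial>M) + (\<integral>\<^sup>+ y. \<integral>\<^sup>+ x. ?b x y \<partial>M \<partial>M)" .
    have "(\<integral>\<^sup>+ x. \<integral>\<^sup>+ y. ?a x y \<partial>M \<partial>M) \<le> (\<integral>\<^sup>+ x. ennreal (1 / 2 * g x powr q) \<partial>M)"
    proof (rule nn_integral_mono)
      fix x assume x: "x \<in> space M"
      have ft: "measure M {y \<in> space M. s < f y} \<le> 1 * s powr (- p)" if "0 < s" for s
      proof -
        have "measure M {y \<in> space M. s < f y} \<le> (\<integral>y. f y powr p \<partial>M) * s powr (- p)"
          using q that by (intro Chebyshev_powr f f0 fint) auto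
        also have "\<dots> \<le> 1 * s powr (- p)"
          by (intro mult_right_mono f1) auto
        finally show ?thesis .
      qed
      have "(\<integral>\<^sup>+ y. ennreal (K x y) * (ennreal (f y) * indicator {y. f y \<le> \<tau> x} y) \<partial>M)
          \<le> ennreal (test_bound * 1 powr \<beta> / (1 - p * \<beta>) * \<tau> x powr (1 - p * \<beta>))"
      proof (rule nn_integral_small_values[OF _ f f0 row_test ft])
        show "p * \<beta> < 1"
        proof -
          have "0 < 1 - p * \<beta>"
            unfolding pb using q by simp
          then show ?thesis by simp
        qed
      qed (use x test_bound_pos beta \<tau>0 in auto)
      also have "test_bound * 1 powr \<beta> / (1 - p * \<beta>) * \<tau> x powr (1 - p * \<beta>) = c * \<delta> powr (p / q) * g x"
        using \<delta> g0[of x] q by (simp add: pb \<tau>_def powr_mult powr_powr c_def)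
      also have "\<dots> = 1 / 2 * g x"
        by (simp only: c\<delta>)
      finally have "ennreal (h x) * (\<integral>\<^sup>+ y. ennreal (K x y) * (ennreal (f y) * indicator {y. f y \<le> \<tau> x} y) \<partial>M)
          \<le> ennreal (h x) * ennreal (1 / 2 * g x)"
        by (intro mult_left_mono) auto
      also have "\<dots> = ennreal (1 / 2 * g x powr q)"
        using h0[of x] g0[of x] by (simp add: ennreal_mult[symmetric] hg[symmetric] del: ennreal_half)
      finally show "(\<integral>\<^sup>+ y. ?a x y \<partial>M) \<le> ennreal (1 / 2 * g x powr q)"
        using x by (subst nn_integral_cmult) (auto simp: indicator_def)
    qed
    also have "\<dots> = ennreal (1 / 2 * I)"
      unfolding I_def
      by (subst nn_integral_eq_integral) (auto intro: integrable_mult_right gint)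
    finally have A: "(\<integral>\<^sup>+ x. \<integral>\<^sup>+ y. ?a x y \<partial>M \<partial>M) \<le> ennreal (1 / 2 * I)" .
    have "(\<integral>\<^sup>+ y. \<integral>\<^sup>+ x. ?b x y \<partial>M \<partial>M) \<le> (\<integral>\<^sup>+ y. ennreal (d * I powr \<beta> * f y powr p) \<partial>M)"
    proof (rule nn_integral_mono)
      fix y assume y: "y \<in> space M"
      have ht: "measure M {x \<in> space M. s < h x} \<le> I * s powr (- q')" if "0 < s" for s
        using Chebyshev_powr[OF h h0, of q' s] gint that q'_pos by (simp add: hq I_def)
      have "(\<integral>\<^sup>+ x. ennreal (K x y) * (ennreal (h x) * indicator {x. h x \<le> \<sigma> y} x) \<partial>M)
          \<le> ennreal (test_bound * I powr \<beta> / (1 - q' * \<beta>) * \<sigma> y powr (1 - q' * \<beta>))"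
        by (rule nn_integral_small_values[OF _ h h0 col_test ht])
          (use y test_bound_pos beta \<sigma>0 I0 qb_pos in auto)
      also have "\<sigma> y powr (1 - q' * \<beta>) = (f y / \<delta>) powr (p - 1)"
        using q by (simp add: qb \<sigma>_def powr_powr)
      also have "test_bound * I powr \<beta> / (1 - q' * \<beta>) * (f y / \<delta>) powr (p - 1) = d * I powr \<beta> * f y powr (p - 1)"
        using \<delta> f0[of y] by (simp add: powr_divide d_def powr_diff mult_ac)
      finally have "ennreal (f y) * (\<integral>\<^sup>+ x. ennreal (K x y) * (ennreal (h x) * indicator {x. h x \<le> \<sigma> y} x) \<partial>M)
          \<le> ennreal (f y) * ennreal (d * I powr \<beta> * f y powr (p - 1))"
        by (intro mult_left_mono) auto
      also have "\<dots> = ennreal (d * I powr \<beta> * f y powr p)"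
        using d f0[of y] by (cases "f y = 0") (auto simp: ennreal_mult[symmetric] powr_diff)
      finally show "(\<integral>\<^sup>+ x. ?b x y \<partial>M) \<le> ennreal (d * I powr \<beta> * f y powr p)"
        using y by (subst nn_integral_cmult) (auto simp: indicator_def)
    qed
    also have "\<dots> = ennreal (d * I powr \<beta> * (\<integral>y. f y powr p \<partial>M))"
      using d by (subst nn_integral_eq_integral) (auto intro!: integrable_mult_right fint)
    also have "\<dots> \<le> ennreal (d * I powr \<beta> * 1)"
      using d f1 by (intro ennreal_leI mult_left_mono) auto
    finally have B: "(\<integral>\<^sup>+ y. \<integral>\<^sup>+ x. ?b x y \<partial>M \<partial>M) \<le> ennreal (d * I powr \<beta>)"
      by simp
    have "ennreal I \<le> ennreal (1 / 2 * I) + ennreal (d * I powr \<beta>)"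
      using sum add_mono[OF A B] by (rule order_trans)
    also have "\<dots> = ennreal (1 / 2 * I + d * I powr \<beta>)"
      using I0 d by (subst ennreal_plus) auto
    finally have "I \<le> 1 / 2 * I + d * I powr \<beta>"
      using I0 d by (subst (asm) ennreal_le_iff) auto
    then have I: "I \<le> 2 * d * I powr \<beta>"
      by simp
    show ?thesis
    proof (cases "I = 0")
      case False
      with I0 have Ip: "0 < I" by simp
      have "I powr (1 - \<beta>) \<le> 2 * d"
        using I Ip by (simp add: powr_diff field_simps)
      then have "(I powr (1 - \<beta>)) powr (1 / (1 - \<beta>)) \<le> (2 * d) powr (1 / (1 - \<beta>))"
        using beta by (intro powr_mono2) auto
      then show ?thesis
        using Ip beta by (simp add: powr_powr I_def)
    qed (simp add: I_def)
  qed
  show ?thesis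
    by (rule that[OF main])
qed

text \<open>
  The bound for \<open>min g n\<close> is uniform in \<open>n\<close>, so monotone convergence removes the boundedness.
\<close>

lemma strong_type_normalized:
  fixes p q :: real
  assumes pq: "1 < p" "p < q" "1 / q = 1 / p - \<beta>"
  obtains C where "0 \<le> C"
    and "\<And>f g :: 'a \<Rightarrow> real. f \<in> borel_measurable M \<Longrightarrow> (\<And>y. 0 \<le> f y) \<Longrightarrow>
      integrable M (\<lambda>y. f y powr p) \<Longrightarrow> (\<integral>y. f y powr p \<partial>M) \<le> 1 \<Longrightarrow>
      g \<in> borel_measurable M \<Longrightarrow> (\<And>x. 0 \<le> g x) \<Longrightarrow>
      (\<And>x. x \<in> space M \<Longrightarrow> ennreal (g x) \<le> (\<integral>\<^sup>+ y. ennreal (K x y * f y) \<partial>M)) \<Longrightarrow>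
      (\<integral>\<^sup>+ x. ennreal (g x powr q) \<partial>M) \<le> ennreal C"
proof -
  obtain C where C: "\<And>(f :: 'a \<Rightarrow> real) (g :: 'a \<Rightarrow> real) N. f \<in> borel_measurable M \<Longrightarrow> (\<And>y. 0 \<le> f y) \<Longrightarrow>
      integrable M (\<lambda>y. f y powr p) \<Longrightarrow> (\<integral>y. f y powr p \<partial>M) \<le> 1 \<Longrightarrow>
      g \<in> borel_measurable M \<Longrightarrow> (\<And>x. 0 \<le> g x) \<Longrightarrow> (\<And>x. g x \<le> N) \<Longrightarrow>
      (\<And>x. x \<in> space M \<Longrightarrow> ennreal (g x) \<le> (\<integral>\<^sup>+ y. ennreal (K x y * f y) \<partial>M)) \<Longrightarrow>
      (\<integral>x. g x powr q \<partial>M) \<le> C"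
    using strong_type_bounded[OF pq] by blast
  have q: "0 < q"
    using pq by simp
  show ?thesis
  proof (rule that[of "max 0 C"])
    fix f g :: "'a \<Rightarrow> real"
    assume f: "f \<in> borel_measurable M" "\<And>y. 0 \<le> f y" "integrable M (\<lambda>y. f y powr p)" "(\<integral>y. f y powr p \<partial>M) \<le> 1"
      and g [measurable]: "g \<in> borel_measurable M" and g0: "\<And>x. 0 \<le> g x"
      and dom: "\<And>x. x \<in> space M \<Longrightarrow> ennreal (g x) \<le> (\<integral>\<^sup>+ y. ennreal (K x y * f y) \<partial>M)"
    let ?v = "\<lambda>n x. min (g x) (real n)"
    have "(\<integral>\<^sup>+ x. ennreal (g x powr q) \<partial>M) = (\<integral>\<^sup>+ x. (SUP n. ennreal (?v n x powr q)) \<partial>M)"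
    proof (rule nn_integral_cong)
      fix x
      obtain n where n: "g x \<le> real n"
        using real_arch_simple by blast
      show "ennreal (g x powr q) = (SUP n. ennreal (?v n x powr q))"
      proof (rule antisym)
        show "ennreal (g x powr q) \<le> (SUP n. ennreal (?v n x powr q))"
          using n by (intro SUP_upper2[of n]) auto
        show "(SUP n. ennreal (?v n x powr q)) \<le> ennreal (g x powr q)"
          using g0 q by (intro SUP_least ennreal_leI powr_mono2) auto
      qed
    qed
    also have "\<dots> = (SUP n. \<integral>\<^sup>+ x. ennreal (?v n x powr q) \<partial>M)"
      using g0 q
      by (intro nn_integral_monotone_convergence_SUP)
         (auto simp: incseq_def le_fun_def intro!: ennreal_leI powr_mono2)
    also have "\<dots> \<le> ennreal (max 0 C)"
    proof (rule SUP_least)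
      fix n
      have "ennreal (?v n x) \<le> (\<integral>\<^sup>+ y. ennreal (K x y * f y) \<partial>M)" if "x \<in> space M" for x
        using dom[OF that] by (rule order_trans[rotated]) (simp add: ennreal_leI)
      then have "(\<integral>x. ?v n x powr q \<partial>M) \<le> C"
        using g0 by (intro C[OF f, where N = "real n"]) auto
      moreover have "integrable M (\<lambda>x. ?v n x powr q)"
        by (rule integrable_const_bound[where B = "real n powr q"]) (use g0 q in \<open>auto intro!: powr_mono2\<close>)
      ultimately show "(\<integral>\<^sup>+ x. ennreal (?v n x powr q) \<partial>M) \<le> ennreal (max 0 C)"
        by (subst nn_integral_eq_integral) (auto intro!: ennreal_leI)
    qed
    finally show "(\<integral>\<^sup>+ x. ennreal (g x powr q) \<partial>M) \<le> ennreal (max 0 C)" .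
  qed simp
qed

text \<open>
  Division of \<open>f\<close> and \<open>g\<close> by the norm of \<open>f\<close> reduces to the normalized case. If that norm is \<open>0\<close>, the
  potential vanishes everywhere and so does \<open>g\<close>.
\<close>

lemma strong_type:
  fixes p q :: real
  assumes pq: "1 < p" "p < q" "1 / q = 1 / p - \<beta>"
  obtains C where "0 \<le> C"
    and "\<And>f g :: 'a \<Rightarrow> real. f \<in> borel_measurable M \<Longrightarrow> (\<And>y. 0 \<le> f y) \<Longrightarrow>
      integrable M (\<lambda>y. f y powr p) \<Longrightarrow> g \<in> borel_measurable M \<Longrightarrow> (\<And>x. 0 \<le> g x) \<Longrightarrow>
      (\<And>x. x \<in> space M \<Longrightarrow> ennreal (g x) \<le> (\<integral>\<^sup>+ y. ennreal (K x y * f y) \<partial>M)) \<Longrightarrow>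
      integrable M (\<lambda>x. g x powr q) \<and>
      (\<integral>x. g x powr q \<partial>M) powr (1 / q) \<le> C * (\<integral>y. f y powr p \<partial>M) powr (1 / p)"
proof -
  obtain C where C0: "0 \<le> C"
    and C: "\<And>f g :: 'a \<Rightarrow> real. f \<in> borel_measurable M \<Longrightarrow> (\<And>y. 0 \<le> f y) \<Longrightarrow>
      integrable M (\<lambda>y. f y powr p) \<Longrightarrow> (\<integral>y. f y powr p \<partial>M) \<le> 1 \<Longrightarrow>
      g \<in> borel_measurable M \<Longrightarrow> (\<And>x. 0 \<le> g x) \<Longrightarrow>
      (\<And>x. x \<in> space M \<Longrightarrow> ennreal (g x) \<le> (\<integral>\<^sup>+ y. ennreal (K x y * f y) \<partial>M)) \<Longrightarrow>
      (\<integral>\<^sup>+ x. ennreal (g x powr q) \<partial>M) \<le> ennreal C"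
    using strong_type_normalized[OF pq] by blast
  have q: "0 < q" "0 < p"
    using pq by auto
  show ?thesis
  proof (rule that[of "C powr (1 / q)"])
    fix f g :: "'a \<Rightarrow> real"
    assume f [measurable]: "f \<in> borel_measurable M" and f0: "\<And>y. 0 \<le> f y"
      and fint: "integrable M (\<lambda>y. f y powr p)"
      and g [measurable]: "g \<in> borel_measurable M" and g0: "\<And>x. 0 \<le> g x"
      and dom: "\<And>x. x \<in> space M \<Longrightarrow> ennreal (g x) \<le> (\<integral>\<^sup>+ y. ennreal (K x y * f y) \<partial>M)"
    define c where "c = (\<integral>y. f y powr p \<partial>M) powr (1 / p)"
    show "integrable M (\<lambda>x. g x powr q) \<and>
      (\<integral>x. g x powr q \<partial>M) powr (1 / q) \<le> C powr (1 / q) * (\<integral>y. f y powr p \<partial>M) powr (1 / p)"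
    proof (cases "c = 0")
      case True
      then have "(\<integral>y. f y powr p \<partial>M) = 0"
        by (simp add: c_def)
      then have f_AE: "AE y in M. f y = 0"
        by (subst (asm) integral_nonneg_eq_0_iff_AE[OF fint]) auto
      \<comment> \<open>The integrand of the potential at any given \<open>x\<close> vanishes almost everywhere.\<close>
      have g_zero: "g x = 0" if x: "x \<in> space M" for x
      proof -
        have "(\<integral>\<^sup>+ y. ennreal (K x y * f y) \<partial>M) = (\<integral>\<^sup>+ y. 0 \<partial>M)"
          using f_AE by (intro nn_integral_cong_AE) auto
        then show ?thesis
          using dom[OF x] g0[of x] by (simp add: ennreal_eq_0_iff)
      qed
      then have "integrable M (\<lambda>x. g x powr q) \<longleftrightarrow> integrable M (\<lambda>x. 0 :: real)"
        by (intro Bochner_Integration.integrable_cong) auto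
      moreover have "(\<integral>x. g x powr q \<partial>M) = (\<integral>x. 0 \<partial>M)"
        using g_zero by (intro Bochner_Integration.integral_cong) auto
      ultimately show ?thesis
        by simp
    next
      case False
      then have c: "0 < c"
        by (simp add: c_def)
      have cp: "c powr p = (\<integral>y. f y powr p \<partial>M)"
        using q by (simp add: c_def powr_powr)
      have "(\<integral>\<^sup>+ x. ennreal ((g x / c) powr q) \<partial>M) \<le> ennreal C"
      proof (rule C[of "\<lambda>y. f y / c"])
        show "integrable M (\<lambda>y. (f y / c) powr p)"
          using f0 c fint by (simp add: powr_divide)
        show "(\<integral>y. (f y / c) powr p \<partial>M) \<le> 1"
          using f0 c by (simp add: powr_divide cp[symmetric])
      next
        fix x assume x: "x \<in> space M"
        have "ennreal (g x / c) = ennreal (1 / c) * ennreal (g x)"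
          using c g0 by (simp add: ennreal_mult[symmetric])
        also have "\<dots> \<le> ennreal (1 / c) * (\<integral>\<^sup>+ y. ennreal (K x y * f y) \<partial>M)"
          by (intro mult_left_mono dom x) simp
        also have "\<dots> = (\<integral>\<^sup>+ y. ennreal (1 / c) * ennreal (K x y * f y) \<partial>M)"
          using x by (intro nn_integral_cmult[symmetric]) auto
        also have "\<dots> = (\<integral>\<^sup>+ y. ennreal (K x y * (f y / c)) \<partial>M)"
          using c f0 K_nonneg by (simp add: ennreal_mult[symmetric])
        finally show "ennreal (g x / c) \<le> (\<integral>\<^sup>+ y. ennreal (K x y * (f y / c)) \<partial>M)" .
      qed (use f0 g0 c in auto)
      then have bound: "(\<integral>\<^sup>+ x. ennreal ((g x / c) powr q) \<partial>M) \<le> ennreal C" .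
      have int: "integrable M (\<lambda>x. (g x / c) powr q)"
        using bound by (intro integrableI_bounded) (auto simp: le_less_trans[OF _ ennreal_less_top])
      then have "(\<integral>x. (g x / c) powr q \<partial>M) \<le> C"
        using bound C0 by (subst (asm) nn_integral_eq_integral) auto
      then have "(\<integral>x. g x powr q \<partial>M) / c powr q \<le> C"
        using g0 c by (simp add: powr_divide)
      then have "(\<integral>x. g x powr q \<partial>M) \<le> C * c powr q"
        using c by (simp add: field_simps)
      then have "(\<integral>x. g x powr q \<partial>M) powr (1 / q) \<le> (C * c powr q) powr (1 / q)"
        using q by (intro powr_mono2) auto
      also have "\<dots> = C powr (1 / q) * c"
        using q c C0 by (simp add: powr_mult powr_powr)
      finally have "(\<integral>x. g x powr q \<partial>M) powr (1 / q) \<le> C powr (1 / q) * c" .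
      moreover have "integrable M (\<lambda>x. c powr q * (g x / c) powr q)"
        by (intro integrable_mult_right int)
      then have "integrable M (\<lambda>x. g x powr q)"
        using g0 c by (simp add: powr_divide)
      ultimately show ?thesis
        by (simp add: c_def)
    qed
  qed simp
qed

end

section \<open>The Gauss measure on admissible balls\<close>

lemma space_gauss [simp]: "space gauss = UNIV"
  by (simp add: gauss_def)

lemma sets_gauss [simp, measurable_cong]: "sets gauss = sets borel"
  by (simp add: gauss_def)

text \<open>
  The Gaussian is a product over coordinates of one-dimensional Gaussians, each a multiple of a normal
  density.
\<close>

lemma nn_integral_exp_neg_norm_sq_finite:
  "(nn_integral lborel (\<lambda>x :: 'a::euclidean_space. ennreal (exp (- (norm x)\<^sup>2)))) < \<infinity>"
proof -
  have "(nn_integral lborel (\<lambda>x :: 'a. ennreal (exp (- (norm x)\<^sup>2))))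
      = (nn_integral lborel (\<lambda>x :: 'a. (\<Prod>b\<in>Basis. ennreal (exp (- (x \<bullet> b)\<^sup>2)))))"
  proof (rule nn_integral_cong)
    fix x :: 'a
    have "(norm x)\<^sup>2 = (\<Sum>b\<in>Basis. (x \<bullet> b)\<^sup>2)"
      unfolding power2_norm_eq_inner by (subst euclidean_inner) (simp add: power2_eq_square)
    then show "ennreal (exp (- (norm x)\<^sup>2)) = (\<Prod>b\<in>Basis. ennreal (exp (- (x \<bullet> b)\<^sup>2)))"
      by (simp add: prod_ennreal exp_sum[symmetric] sum_negf)
  qed
  also have "\<dots> = (\<Prod>b\<in>(Basis::'a set). (\<integral>\<^sup>+ t. ennreal (exp (- t\<^sup>2)) \<partial>lborel))"
    by (rule nn_integral_lborel_prod) auto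
  also have "(\<integral>\<^sup>+ t. ennreal (exp (- t\<^sup>2)) \<partial>lborel) < \<infinity>"
  proof -
    have "integrable lborel (\<lambda>t. sqrt pi * normal_density 0 (1 / sqrt 2) t)"
      by (intro integrable_mult_right integrable_normal_density) simp
    also have "(\<lambda>t. sqrt pi * normal_density 0 (1 / sqrt 2) t) = (\<lambda>t. exp (- t\<^sup>2))"
      by (auto simp: normal_density_def power_divide)
    finally show ?thesis
      by (simp add: integrable_iff_bounded)
  qed
  then have "(\<Prod>b\<in>(Basis::'a set). (\<integral>\<^sup>+ t. ennreal (exp (- t\<^sup>2)) \<partial>lborel)) < \<infinity>"
    by (simp add: ennreal_prod_eq_top power_less_top_ennreal)
  finally show ?thesis .
qed

lemma finite_measure_gauss: "finite_measure (gauss :: (real ^ 'n) measure)"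
proof
  let ?c = "pi powr (- (real CARD('n) / 2))"
  have "emeasure gauss (space gauss :: (real ^ 'n) set)
      = (nn_integral lborel (\<lambda>x :: real ^ 'n. ennreal (?c * exp (- (norm x)\<^sup>2))))"
    unfolding gauss_def by (simp add: emeasure_density)
  also have "\<dots> = ennreal ?c * (nn_integral lborel (\<lambda>x :: real ^ 'n. ennreal (exp (- (norm x)\<^sup>2))))"
    by (subst nn_integral_cmult[symmetric]) (auto simp: ennreal_mult)
  also have "\<dots> < \<infinity>"
    using nn_integral_exp_neg_norm_sq_finite[where 'a = "real ^ 'n"] by (simp add: ennreal_mult_less_top)
  finally show "emeasure gauss (space gauss :: (real ^ 'n) set) \<noteq> \<infinity>"
    by simp
qed

interpretation gauss: finite_measure "gauss :: (real ^ 'n) measure"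
  by (rule finite_measure_gauss)

lemma emeasure_gauss:
  assumes "S \<in> sets borel"
  shows "emeasure gauss (S :: (real ^ 'n) set)
      = (\<integral>\<^sup>+ x. ennreal (pi powr (- (real CARD('n) / 2)) * exp (- (norm x)\<^sup>2)) * indicator S x \<partial>lborel)"
  using assms unfolding gauss_def by (simp add: emeasure_density)

text \<open>
  On sets where the density is comparable to a constant, the Gauss measure of a ball is that constant
  times its volume; the next two lemmas are the upper and the lower half of this remark.
\<close>

lemma measure_gauss_le:
  fixes S :: "(real ^ 'n) set"
  assumes S [measurable]: "S \<in> sets borel" and sub: "S \<subseteq> cball b \<rho>" and "0 \<le> \<rho>"
    and H: "\<And>z. z \<in> S \<Longrightarrow> exp (- (norm z)\<^sup>2) \<le> H" and "0 \<le> H"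
  shows "measure gauss S \<le> pi powr (- (real CARD('n) / 2)) * H * (unit_ball_vol (real CARD('n)) * \<rho> ^ CARD('n))"
proof -
  let ?c = "pi powr (- (real CARD('n) / 2))"
  have "ennreal (measure gauss S) = emeasure gauss S"
    by (simp add: gauss.emeasure_eq_measure)
  also have "\<dots> = (\<integral>\<^sup>+ x. ennreal (?c * exp (- (norm x)\<^sup>2)) * indicator S x \<partial>lborel)"
    by (simp add: emeasure_gauss)
  also have "\<dots> \<le> (\<integral>\<^sup>+ x. ennreal (?c * H) * indicator (cball b \<rho>) x \<partial>lborel)"
  proof (rule nn_integral_mono)
    fix x
    show "ennreal (?c * exp (- (norm x)\<^sup>2)) * indicator S x \<le> ennreal (?c * H) * indicator (cball b \<rho>) x"
      using H[of x] sub by (cases "x \<in> S") (auto intro!: ennreal_leI mult_left_mono simp: subset_iff indicator_def)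
  qed
  also have "\<dots> = ennreal (?c * H) * emeasure lborel (cball b \<rho>)"
    by (simp add: nn_integral_cmult_indicator)
  also have "\<dots> = ennreal (?c * H * (unit_ball_vol (real CARD('n)) * \<rho> ^ CARD('n)))"
    using assms by (simp add: emeasure_cball ennreal_mult)
  finally show ?thesis
    using assms by (subst (asm) ennreal_le_iff) auto
qed

lemma measure_gauss_ball_ge:
  fixes b :: "real ^ 'n"
  assumes "0 \<le> \<rho>" and H: "\<And>z. z \<in> ball b \<rho> \<Longrightarrow> H \<le> exp (- (norm z)\<^sup>2)" and "0 \<le> H"
  shows "pi powr (- (real CARD('n) / 2)) * H * (unit_ball_vol (real CARD('n)) * \<rho> ^ CARD('n)) \<le> measure gauss (ball b \<rho>)"
proof -
  let ?c = "pi powr (- (real CARD('n) / 2))"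
  have "ennreal (?c * H * (unit_ball_vol (real CARD('n)) * \<rho> ^ CARD('n))) = ennreal (?c * H) * emeasure lborel (ball b \<rho>)"
    using assms by (simp add: emeasure_ball ennreal_mult)
  also have "\<dots> = (\<integral>\<^sup>+ x. ennreal (?c * H) * indicator (ball b \<rho>) x \<partial>lborel)"
    by (simp add: nn_integral_cmult_indicator)
  also have "\<dots> \<le> (\<integral>\<^sup>+ x. ennreal (?c * exp (- (norm x)\<^sup>2)) * indicator (ball b \<rho>) x \<partial>lborel)"
  proof (rule nn_integral_mono)
    fix x
    show "ennreal (?c * H) * indicator (ball b \<rho>) x \<le> ennreal (?c * exp (- (norm x)\<^sup>2)) * indicator (ball b \<rho>) x"
      using H[of x] by (cases "x \<in> ball b \<rho>") (auto intro!: ennreal_leI mult_left_mono)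
  qed
  also have "\<dots> = ennreal (measure gauss (ball b \<rho>))"
    by (simp add: emeasure_gauss gauss.emeasure_eq_measure[symmetric])
  finally show ?thesis
    by simp
qed

lemma adm_le_one: "adm x \<le> 1"
  by (simp add: adm_def)

lemma adm_mult_norm_le: "adm x * norm x \<le> 1"
proof (cases "x = 0")
  case False
  then have "adm x * norm x \<le> (1 / norm x) * norm x"
    by (intro mult_right_mono) (auto simp: adm_def)
  then show ?thesis
    using False by simp
qed simp

lemma adm_measurable [measurable]: "adm \<in> borel_measurable borel"
  unfolding adm_def by measurable

text \<open>
  The admissible radius is chosen for this: moving by \<open>t \<le> a * adm x\<close> changes the squared norm by at
  most \<open>2 * t * norm x + t\<^sup>2\<close>, and both \<open>adm x * norm x\<close> and \<open>adm x\<close> are at most \<open>1\<close>. Hence the density of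
  the Gauss measure is constant up to a factor on admissible balls.
\<close>

lemma norm_sq_diff_le:
  assumes "dist x y < a * adm x" "0 < a"
  shows "\<bar>(norm x)\<^sup>2 - (norm y)\<^sup>2\<bar> \<le> a\<^sup>2 + 2 * a"
proof -
  let ?d = "dist x y"
  have d: "\<bar>norm x - norm y\<bar> \<le> ?d"
    by (simp add: dist_norm norm_triangle_ineq3)
  have "?d \<le> a"
    using assms mult_left_mono[OF adm_le_one[of x], of a] by linarith
  then have d2: "?d * ?d \<le> a * a"
    using assms by (intro mult_mono) auto
  have "?d * norm x \<le> a * adm x * norm x"
    using assms by (intro mult_right_mono) auto
  also have "\<dots> \<le> a * 1"
    using assms adm_mult_norm_le[of x] by (simp only: mult.assoc) (intro mult_left_mono, auto)
  finally have dx: "?d * norm x \<le> a" by simp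
  have "\<bar>(norm x)\<^sup>2 - (norm y)\<^sup>2\<bar> = \<bar>norm x - norm y\<bar> * (norm x + norm y)"
    by (simp add: power2_eq_square square_diff_square_factored abs_mult mult.commute)
  also have "\<dots> \<le> ?d * (2 * norm x + ?d)"
    using d by (intro mult_mono) auto
  also have "\<dots> \<le> a\<^sup>2 + 2 * a"
    using d2 dx by (simp add: algebra_simps power2_eq_square)
  finally show ?thesis .
qed

lemma exp_norm_sq_comparable:
  assumes "dist x y < a * adm x" "0 < a"
  shows "exp (- (norm y)\<^sup>2) \<le> exp (a\<^sup>2 + 2 * a) * exp (- (norm x)\<^sup>2)"
    and "exp (- (norm x)\<^sup>2) \<le> exp (a\<^sup>2 + 2 * a) * exp (- (norm y)\<^sup>2)"
  using norm_sq_diff_le[OF assms] by (simp_all add: exp_add[symmetric])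

text \<open>
  The second hypothesis on \<open>S\<close> confines it to a ball around \<open>b\<close> whose Gaussian weight at \<open>b\<close> times volume
  is a multiple of \<open>s\<close>; the first one makes this the size of the Gauss measure. Super-level
  sets of the rows and of the columns of the kernel are both of this form, with \<open>b\<close> the fixed variable.
\<close>

lemma measure_gauss_weighted_ball_le:
  fixes S :: "(real ^ 'n) set"
  assumes S: "S \<in> sets borel" and "0 < c" "0 \<le> s"
    and S1: "\<And>z. z \<in> S \<Longrightarrow> exp (- (norm z)\<^sup>2) \<le> c * exp (- (norm b)\<^sup>2)"
    and S2: "\<And>z. z \<in> S \<Longrightarrow> exp (- (norm b)\<^sup>2) * dist b z ^ CARD('n) \<le> s"
  shows "measure gauss S \<le> pi powr (- (real CARD('n) / 2)) * unit_ball_vol (real CARD('n)) * c * s"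
proof -
  \<comment> \<open>The radius at which the weighted power \<open>exp (- (norm b)\<^sup>2) * \<rho> ^ CARD('n)\<close> equals \<open>s\<close>.\<close>
  define \<rho> where "\<rho> = root CARD('n) (s * exp ((norm b)\<^sup>2))"
  have \<rho>: "0 \<le> \<rho>" "\<rho> ^ CARD('n) = s * exp ((norm b)\<^sup>2)"
    using assms by (auto simp: \<rho>_def)
  have "S \<subseteq> cball b \<rho>"
  proof
    fix z assume "z \<in> S"
    then have "dist b z ^ CARD('n) \<le> \<rho> ^ CARD('n)"
      using S2[of z] by (simp add: \<rho> exp_minus field_simps)
    then show "z \<in> cball b \<rho>"
      using \<rho>(1) by (simp add: power_mono_iff)
  qed
  then have "measure gauss S \<le> pi powr (- (real CARD('n) / 2)) * (c * exp (- (norm b)\<^sup>2)) *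
      (unit_ball_vol (real CARD('n)) * \<rho> ^ CARD('n))"
    using assms \<rho> by (intro measure_gauss_le S S1) auto
  also have "\<dots> = pi powr (- (real CARD('n) / 2)) * unit_ball_vol (real CARD('n)) * c * s"
    by (simp add: \<rho> exp_minus)
  finally show ?thesis .
qed

section \<open>The local fractional integral operators\<close>

text \<open>
  The common form of the two kernels, with \<open>W\<close> the Gauss volume for the first operator and the weighted
  power of the distance for the second. On the diagonal \<open>W\<close> is \<open>0\<close>, and the kernel is then \<open>0\<close> because
  \<open>0 powr s = 0\<close> and \<open>1 / 0 = 0\<close>.
\<close>

definition local_kernel :: "real \<Rightarrow> real \<Rightarrow> (real ^ 'n \<Rightarrow> real ^ 'n \<Rightarrow> real) \<Rightarrow> real ^ 'n \<Rightarrow> real ^ 'n \<Rightarrow> real" where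
  "local_kernel a \<beta> W x y = (if y \<in> ball x (a * adm x) then 1 / W x y powr (1 - \<beta>) else 0)"

text \<open>
  A lower bound for \<open>W\<close> suffices: where the kernel exceeds \<open>t\<close>, the points are at admissible distance
  and \<open>exp (- (norm x)\<^sup>2) * dist x y ^ CARD('n)\<close> is at most a multiple of \<open>t powr (- (1 / (1 - \<beta>)))\<close>. By
  comparability of the densities the weight may be evaluated at \<open>x\<close> or at \<open>y\<close>, which gives the tails of
  the rows and of the columns.
\<close>

lemma weak_kernel_local:
  fixes W :: "real ^ 'n \<Rightarrow> real ^ 'n \<Rightarrow> real"
  assumes "0 < a" and beta: "0 < \<beta>" "\<beta> < 1" and "0 < \<kappa>"
    and W [measurable]: "(\<lambda>(x, y). W x y) \<in> borel_measurable (borel \<Otimes>\<^sub>M borel)"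
    and W0: "\<And>x y. 0 \<le> W x y"
    and W_ge: "\<And>x y. dist x y < a * adm x \<Longrightarrow> \<kappa> * (exp (- (norm x)\<^sup>2) * dist x y ^ CARD('n)) \<le> W x y"
  shows "\<exists>A. weak_kernel gauss (local_kernel a \<beta> W) A \<beta>"
proof -
  define c where "c = exp (a\<^sup>2 + 2 * a)"
  have c: "0 < c" "1 \<le> c"
    using \<open>0 < a\<close> by (auto simp: c_def)
  define A where "A = pi powr (- (real CARD('n) / 2)) * unit_ball_vol (real CARD('n)) * c * (c / \<kappa>)"
  have [measurable]: "(\<lambda>(x, y). local_kernel a \<beta> W x y) \<in> borel_measurable (borel \<Otimes>\<^sub>M borel)"
    unfolding local_kernel_def mem_ball by measurable
  have large: "dist x y < a * adm x \<and> exp (- (norm x)\<^sup>2) * dist x y ^ CARD('n) \<le> t powr (- (1 / (1 - \<beta>))) / \<kappa>"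
    if t: "0 < t" and *: "t < local_kernel a \<beta> W x y" for x y :: "real ^ 'n" and t
  proof -
    have d: "dist x y < a * adm x" and tW: "t < 1 / W x y powr (1 - \<beta>)"
      using t * by (auto simp: local_kernel_def split: if_splits)
    have "W x y \<noteq> 0"
      using t tW by auto
    then have Wp: "0 < W x y"
      using W0[of x y] by linarith
    then have "W x y powr (1 - \<beta>) \<le> 1 / t"
      using t tW by (simp add: field_simps)
    then have "(W x y powr (1 - \<beta>)) powr (1 / (1 - \<beta>)) \<le> (1 / t) powr (1 / (1 - \<beta>))"
      using beta by (intro powr_mono2) auto
    then have "W x y \<le> t powr (- (1 / (1 - \<beta>)))"
      using Wp beta t by (simp add: powr_powr powr_divide powr_minus_divide)
    with W_ge[OF d] have "\<kappa> * (exp (- (norm x)\<^sup>2) * dist x y ^ CARD('n)) \<le> t powr (- (1 / (1 - \<beta>)))"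
      by linarith
    with d \<open>0 < \<kappa>\<close> show ?thesis
      by (simp add: field_simps)
  qed
  have "weak_kernel gauss (local_kernel a \<beta> W) A \<beta>"
  proof
    show "(\<lambda>(x, y). local_kernel a \<beta> W x y) \<in> borel_measurable (gauss \<Otimes>\<^sub>M gauss)"
      by measurable
    show "0 \<le> local_kernel a \<beta> W x y" for x y
      by (simp add: local_kernel_def)
    show "0 < \<beta>" "\<beta> < 1" by fact+
  next
    fix x :: "real ^ 'n" and t :: real assume t: "0 < t"
    let ?s = "t powr (- (1 / (1 - \<beta>))) / \<kappa>"
    have "measure gauss {y. t < local_kernel a \<beta> W x y}
        \<le> pi powr (- (real CARD('n) / 2)) * unit_ball_vol (real CARD('n)) * c * (c * ?s)"
    proof (rule measure_gauss_weighted_ball_le[where b = x])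
      fix y assume y: "y \<in> {y. t < local_kernel a \<beta> W x y}"
      then have d: "dist x y < a * adm x" and le: "exp (- (norm x)\<^sup>2) * dist x y ^ CARD('n) \<le> ?s"
        using large[OF t] by auto
      show "exp (- (norm y)\<^sup>2) \<le> c * exp (- (norm x)\<^sup>2)"
        unfolding c_def by (rule exp_norm_sq_comparable[OF d \<open>0 < a\<close>])
      have "?s \<le> c * ?s"
        using mult_right_mono[of 1 c ?s] c \<open>0 < \<kappa>\<close> by simp
      with le show "exp (- (norm x)\<^sup>2) * dist x y ^ CARD('n) \<le> c * ?s"
        by linarith
    qed (use c \<open>0 < \<kappa>\<close> in auto)
    then show "measure gauss {y \<in> space gauss. t < local_kernel a \<beta> W x y} \<le> A * t powr (- (1 / (1 - \<beta>)))"
      by (simp add: A_def)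
  next
    fix y :: "real ^ 'n" and t :: real assume t: "0 < t"
    let ?s = "t powr (- (1 / (1 - \<beta>))) / \<kappa>"
    have "measure gauss {x. t < local_kernel a \<beta> W x y}
        \<le> pi powr (- (real CARD('n) / 2)) * unit_ball_vol (real CARD('n)) * c * (c * ?s)"
    proof (rule measure_gauss_weighted_ball_le[where b = y])
      fix x assume x: "x \<in> {x. t < local_kernel a \<beta> W x y}"
      then have d: "dist x y < a * adm x" and le: "exp (- (norm x)\<^sup>2) * dist x y ^ CARD('n) \<le> ?s"
        using large[OF t] by auto
      show "exp (- (norm x)\<^sup>2) \<le> c * exp (- (norm y)\<^sup>2)"
        unfolding c_def by (rule exp_norm_sq_comparable[OF d \<open>0 < a\<close>])
      have "exp (- (norm y)\<^sup>2) * dist y x ^ CARD('n) \<le> c * exp (- (norm x)\<^sup>2) * dist x y ^ CARD('n)"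
        unfolding c_def dist_commute[of y x]
        by (intro mult_right_mono exp_norm_sq_comparable[OF d \<open>0 < a\<close>]) auto
      also have "\<dots> \<le> c * ?s"
        using le c by (simp only: mult.assoc) (intro mult_left_mono, auto)
      finally show "exp (- (norm y)\<^sup>2) * dist y x ^ CARD('n) \<le> c * ?s" .
    qed (use c \<open>0 < \<kappa>\<close> in auto)
    then show "measure gauss {x \<in> space gauss. t < local_kernel a \<beta> W x y} \<le> A * t powr (- (1 / (1 - \<beta>)))"
      by (simp add: A_def)
  qed
  then show ?thesis ..
qed

lemma Lp_subset_L1:
  fixes f :: "real ^ 'n \<Rightarrow> 'k::{real_normed_field, euclidean_space}"
  assumes "f \<in> Lp p" "1 \<le> p"
  shows "integrable gauss (\<lambda>x. norm (f x))"
proof (rule Bochner_Integration.integrable_bound)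
  show "integrable gauss (\<lambda>x. 1 + norm (f x) powr p)"
    using assms by (auto simp: Lp_def)
  show "(\<lambda>x. norm (f x)) \<in> borel_measurable gauss"
    using assms by (auto simp: Lp_def)
  have "norm (f x) \<le> 1 + norm (f x) powr p" for x
  proof (cases "norm (f x) \<le> 1")
    case False
    then have "norm (f x) powr 1 \<le> norm (f x) powr p"
      using assms by (intro powr_mono) auto
    then show ?thesis using False by simp
  qed (simp add: add_increasing2)
  then show "AE x in gauss. norm (norm (f x)) \<le> norm (1 + norm (f x) powr p)"
    by auto
qed

text \<open>
  The norm of \<open>T f x\<close> is at most the potential of the norm of \<open>f\<close>, also where the defining integral
  diverges, since \<open>T f x\<close> is \<open>0\<close> there. That this happens only on a null set follows from the finiteness of
  the potential almost everywhere, as \<open>L\<^sup>p\<close> is contained in \<open>L\<^sup>1\<close> for a finite measure.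
\<close>

lemma bounded_local_operator:
  fixes W :: "real ^ 'n \<Rightarrow> real ^ 'n \<Rightarrow> real" and a \<beta> p q \<kappa> :: real
    and T :: "(real ^ 'n \<Rightarrow> 'k::{real_normed_field, euclidean_space}) \<Rightarrow> real ^ 'n \<Rightarrow> 'k"
  assumes "0 < a" "0 < \<beta>" "\<beta> < 1" "0 < \<kappa>"
    and W [measurable]: "(\<lambda>(x, y). W x y) \<in> borel_measurable (borel \<Otimes>\<^sub>M borel)"
    and W0: "\<And>x y. 0 \<le> W x y"
    and W_ge: "\<And>x y. dist x y < a * adm x \<Longrightarrow> \<kappa> * (exp (- (norm x)\<^sup>2) * dist x y ^ CARD('n)) \<le> W x y"
    and T: "\<And>f x. T f x = (LINT y:ball x (a * adm x)|gauss. f y / of_real (W x y powr (1 - \<beta>)))"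
    and D: "\<And>f x. D f x \<longleftrightarrow> set_integrable gauss (ball x (a * adm x)) (\<lambda>y. f y / of_real (W x y powr (1 - \<beta>)))"
    and pq: "1 < p" "p < q" "1 / q = 1 / p - \<beta>"
  shows "bounded_operator D T (Lp p) (Lp_norm p) (Lp q) (Lp_norm q)"
    and "bounded_operator D T (Lp 1) (Lp_norm 1) (weak_Lp (1 / (1 - \<beta>))) (weak_Lp_norm (1 / (1 - \<beta>)))"
proof -
  obtain A where "weak_kernel gauss (local_kernel a \<beta> W) A \<beta>"
    using weak_kernel_local[OF assms(1-7)] by blast
  then interpret weak_kernel "gauss :: (real ^ 'n) measure" "local_kernel a \<beta> W" A \<beta> .
  let ?u = "\<lambda>f x. \<integral>\<^sup>+ y. ennreal (local_kernel a \<beta> W x y * norm (f y :: 'k)) \<partial>gauss"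
  let ?F = "\<lambda>f x y. indicator (ball x (a * adm x)) y *\<^sub>R (f y / of_real (W x y powr (1 - \<beta>))) :: 'k"
  have normF: "norm (?F f x y) = local_kernel a \<beta> W x y * norm (f y)" for f x y
    by (simp add: local_kernel_def norm_divide indicator_def)
  have F_meas: "(\<lambda>(x, y). ?F f x y) \<in> borel_measurable (gauss \<Otimes>\<^sub>M gauss)"
    if [measurable]: "f \<in> borel_measurable gauss" for f
  proof -
    have [measurable]: "f \<in> borel_measurable borel"
      using that by (simp cong: measurable_cong_sets)
    have "(\<lambda>(x, y). ?F f x y) = (\<lambda>(x, y). if dist x y < a * adm x then f y / of_real (W x y powr (1 - \<beta>)) else 0)"
      by (auto simp: fun_eq_iff indicator_def)
    also have "\<dots> \<in> borel_measurable (borel \<Otimes>\<^sub>M borel)"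
      by measurable
    finally show ?thesis
      by (simp cong: measurable_cong_sets sets_pair_measure_cong)
  qed
  \<comment> \<open>Joint measurability gives the measurability of each section.\<close>
  have F_meas2: "?F f x \<in> borel_measurable gauss" if "f \<in> borel_measurable gauss" for f x
    using measurable_compose[OF measurable_Pair1'[of x gauss gauss] F_meas[OF that]] by simp
  have T_meas: "T f \<in> borel_measurable gauss" if f: "f \<in> borel_measurable gauss" for f
  proof -
    have "(\<lambda>x. \<integral>y. ?F f x y \<partial>gauss) \<in> borel_measurable gauss"
      using F_meas[OF f] by (rule gauss.borel_measurable_lebesgue_integral)
    also have "(\<lambda>x. \<integral>y. ?F f x y \<partial>gauss) = T f"
      by (simp add: fun_eq_iff T set_lebesgue_integral_def)
    finally show ?thesis .
  qed
  have dom: "ennreal (norm (T f x)) \<le> ?u f x" for f x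
  proof (cases "integrable gauss (?F f x)")
    case True
    from integral_norm_bound_ennreal[OF this] show ?thesis
      by (simp only: normF T set_lebesgue_integral_def)
  next
    case False
    then show ?thesis
      by (simp add: T set_lebesgue_integral_def not_integrable_integral_eq)
  qed
  have defined: "AE x in gauss. D f x" if f: "f \<in> Lp r" and "1 \<le> r" for f r
  proof -
    have "AE x in gauss. ?u f x < \<infinity>"
      using Lp_subset_L1[OF that] by (rule potential_finite_AE) simp
    then show ?thesis
    proof eventually_elim
      case (elim x)
      show ?case
        unfolding D set_integrable_def
      proof (rule integrableI_bounded)
        show "?F f x \<in> borel_measurable gauss"
          using f by (intro F_meas2) (simp add: Lp_def)
        show "(\<integral>\<^sup>+ y. ennreal (norm (?F f x y)) \<partial>gauss) < \<infinity>"
          using elim by (simp only: normF)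
      qed
    qed
  qed
  show "bounded_operator D T (Lp p) (Lp_norm p) (Lp q) (Lp_norm q)"
    unfolding bounded_operator_def
  proof (intro conjI ballI)
    show "AE x in gauss. D f x" if "f \<in> Lp p" for f
      using defined[OF that] pq by simp
    obtain C where C: "0 \<le> C" and bound: "\<And>f g :: real ^ 'n \<Rightarrow> real. f \<in> borel_measurable gauss \<Longrightarrow> (\<And>y. 0 \<le> f y) \<Longrightarrow>
      integrable gauss (\<lambda>y. f y powr p) \<Longrightarrow> g \<in> borel_measurable gauss \<Longrightarrow> (\<And>x. 0 \<le> g x) \<Longrightarrow>
      (\<And>x. x \<in> space gauss \<Longrightarrow> ennreal (g x) \<le> (\<integral>\<^sup>+ y. ennreal (local_kernel a \<beta> W x y * f y) \<partial>gauss)) \<Longrightarrow>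
      integrable gauss (\<lambda>x. g x powr q) \<and>
      (\<integral>x. g x powr q \<partial>gauss) powr (1 / q) \<le> C * (\<integral>y. f y powr p \<partial>gauss) powr (1 / p)"
      using strong_type[OF pq] by blast
    show "\<exists>C\<ge>0. \<forall>f\<in>Lp p. T f \<in> Lp q \<and> Lp_norm q (T f) \<le> C * Lp_norm p f"
    proof (intro exI[of _ C] conjI ballI C)
      fix f :: "real ^ 'n \<Rightarrow> 'k" assume f: "f \<in> Lp p"
      have *: "integrable gauss (\<lambda>x. norm (T f x) powr q) \<and>
        (\<integral>x. norm (T f x) powr q \<partial>gauss) powr (1 / q) \<le> C * (\<integral>y. norm (f y) powr p \<partial>gauss) powr (1 / p)"
        using f T_meas[of f] by (intro bound dom) (auto simp: Lp_def)
      then show "T f \<in> Lp q" "Lp_norm q (T f) \<le> C * Lp_norm p f"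
        using f T_meas[of f] by (auto simp: Lp_def Lp_norm_def)
    qed
  qed
  show "bounded_operator D T (Lp 1) (Lp_norm 1) (weak_Lp (1 / (1 - \<beta>))) (weak_Lp_norm (1 / (1 - \<beta>)))"
    unfolding bounded_operator_def
  proof (intro conjI ballI)
    show "AE x in gauss. D f x" if "f \<in> Lp 1" for f
      using defined[OF that] by simp
    show "\<exists>C\<ge>0. \<forall>f\<in>Lp 1. T f \<in> weak_Lp (1 / (1 - \<beta>)) \<and> weak_Lp_norm (1 / (1 - \<beta>)) (T f) \<le> C * Lp_norm 1 f"
    proof (intro exI[of _ test_bound] conjI ballI)
      show "0 \<le> test_bound"
        using test_bound_pos by simp
      fix f :: "real ^ 'n \<Rightarrow> 'k" assume f: "f \<in> Lp 1"
      have norm: "Lp_norm 1 f = (\<integral>y. norm (f y) \<partial>gauss)"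
        by (simp add: Lp_norm_def)
      have bound: "l * measure gauss {x. l < norm (T f x)} powr (1 - \<beta>) \<le> test_bound * Lp_norm 1 f" if "0 < l" for l
        using weak_type[OF Lp_subset_L1[OF f] _ _ dom that] f T_meas[of f] by (simp add: norm Lp_def)
      then show "weak_Lp_norm (1 / (1 - \<beta>)) (T f) \<le> test_bound * Lp_norm 1 f"
        unfolding weak_Lp_norm_def by (intro cSUP_least) auto
      show "T f \<in> weak_Lp (1 / (1 - \<beta>))"
        using bound f T_meas[of f] by (auto simp: weak_Lp_def Lp_def intro!: bdd_aboveI2)
    qed
  qed
qed

lemma gvol_ge:
  fixes x y :: "real ^ 'n"
  assumes "0 < a" "dist x y < a * adm x"
  shows "pi powr (- (real CARD('n) / 2)) * unit_ball_vol (real CARD('n)) / exp (a\<^sup>2 + 2 * a) *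
      (exp (- (norm x)\<^sup>2) * dist x y ^ CARD('n)) \<le> gvol x y"
proof -
  have "exp (- (norm x)\<^sup>2) / exp (a\<^sup>2 + 2 * a) \<le> exp (- (norm z)\<^sup>2)" if "z \<in> ball x (dist x y)" for z
    using exp_norm_sq_comparable(2)[of x z a] that assms by (simp add: field_simps)
  from measure_gauss_ball_ge[OF _ this, where \<rho> = "dist x y"] show ?thesis
    by (simp add: gvol_def dist_norm field_simps)
qed

text \<open>
  The volume is the measure of a section of the open set of all \<open>((x, y), z)\<close> with
  \<open>dist x z < dist x y\<close>, so its measurability is part of Tonelli's theorem.
\<close>

lemma gvol_measurable:
  "(\<lambda>(x, y). gvol x y) \<in> borel_measurable (borel \<Otimes>\<^sub>M (borel :: (real ^ 'n) measure))"
proof -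
  let ?Q = "{w :: ((real ^ 'n) \<times> (real ^ 'n)) \<times> (real ^ 'n). dist (fst (fst w)) (snd w) < dist (fst (fst w)) (snd (fst w))}"
  have "open ?Q"
    by (intro open_Collect_less continuous_intros)
  then have "?Q \<in> sets (borel :: (((real ^ 'n) \<times> (real ^ 'n)) \<times> (real ^ 'n)) measure)"
    by simp
  then have "?Q \<in> sets (borel \<Otimes>\<^sub>M (gauss :: (real ^ 'n) measure))"
    by (simp add: borel_prod[symmetric] cong: sets_pair_measure_cong)
  then have "(\<lambda>w. emeasure gauss (Pair w -` ?Q)) \<in> borel_measurable borel"
    by (rule gauss.measurable_emeasure_Pair)
  then have "(\<lambda>w. measure gauss (Pair w -` ?Q)) \<in> borel_measurable borel"
    unfolding measure_def by measurable
  also have "(\<lambda>w. measure gauss (Pair w -` ?Q)) = (\<lambda>(x, y). gvol x y)"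
    by (auto simp: fun_eq_iff gvol_def dist_norm intro!: arg_cong[where f = "measure gauss"])
  finally show ?thesis
    by (simp add: borel_prod)
qed

theorem theorem3p1:
  fixes a \<beta> p q :: real
  assumes "0 < a" and "0 < \<beta>" and "\<beta> < 1"
    and "1 < p" and "p < q" and "1 / q = 1 / p - \<beta>"
  shows
    "bounded_operator (frac_defined a \<beta>) (frac_int a \<beta>)
       (Lp p :: (real ^ 'n \<Rightarrow> 'k::{real_normed_field, euclidean_space}) set) (Lp_norm p)
       (Lp q) (Lp_norm q) \<and>
     bounded_operator (frac_defined a \<beta>) (frac_int a \<beta>)
       (Lp 1 :: (real ^ 'n \<Rightarrow> 'k) set) (Lp_norm 1)
       (weak_Lp (1 / (1 - \<beta>))) (weak_Lp_norm (1 / (1 - \<beta>))) \<and>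
     bounded_operator (frac_defined_tilde a \<beta>) (frac_int_tilde a \<beta>)
       (Lp p :: (real ^ 'n \<Rightarrow> 'k) set) (Lp_norm p)
       (Lp q) (Lp_norm q) \<and>
     bounded_operator (frac_defined_tilde a \<beta>) (frac_int_tilde a \<beta>)
       (Lp 1 :: (real ^ 'n \<Rightarrow> 'k) set) (Lp_norm 1)
       (weak_Lp (1 / (1 - \<beta>))) (weak_Lp_norm (1 / (1 - \<beta>)))"
proof -
  have tilde_measurable: "(\<lambda>(x :: real ^ 'n, y). exp (- (norm x)\<^sup>2) * norm (x - y) ^ CARD('n))
      \<in> borel_measurable (borel \<Otimes>\<^sub>M borel)"
    by measurable
  have const_pos: "0 < pi powr (- (real CARD('n) / 2)) * unit_ball_vol (real CARD('n)) / exp (a\<^sup>2 + 2 * a)"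
    by simp
  have gvol_nonneg: "0 \<le> gvol x y" for x y :: "real ^ 'n"
    by (simp add: gvol_def)
  note I = bounded_local_operator[OF assms(1-3) const_pos gvol_measurable gvol_nonneg gvol_ge[OF assms(1)]
      _ _ assms(4-6), where T = "frac_int a \<beta>" and D = "frac_defined a \<beta>" and 'k = 'k]
  note I_tilde = bounded_local_operator[OF assms(1-3) zero_less_one tilde_measurable _ _ _ _ assms(4-6),
      where T = "frac_int_tilde a \<beta>" and D = "frac_defined_tilde a \<beta>" and 'k = 'k]
  show ?thesis
  proof (intro conjI)
    show "bounded_operator (frac_defined a \<beta>) (frac_int a \<beta>)
       (Lp p :: (real ^ 'n \<Rightarrow> 'k) set) (Lp_norm p) (Lp q) (Lp_norm q)"
      by (rule I(1)) (simp_all add: frac_int_def frac_defined_def frac_integrand_def[abs_def])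
    show "bounded_operator (frac_defined a \<beta>) (frac_int a \<beta>)
       (Lp 1 :: (real ^ 'n \<Rightarrow> 'k) set) (Lp_norm 1) (weak_Lp (1 / (1 - \<beta>))) (weak_Lp_norm (1 / (1 - \<beta>)))"
      by (rule I(2)) (simp_all add: frac_int_def frac_defined_def frac_integrand_def[abs_def])
    show "bounded_operator (frac_defined_tilde a \<beta>) (frac_int_tilde a \<beta>)
       (Lp p :: (real ^ 'n \<Rightarrow> 'k) set) (Lp_norm p) (Lp q) (Lp_norm q)"
      by (rule I_tilde(1))
         (simp_all add: frac_int_tilde_def frac_defined_tilde_def frac_integrand_tilde_def[abs_def] dist_norm)
    show "bounded_operator (frac_defined_tilde a \<beta>) (frac_int_tilde a \<beta>)
       (Lp 1 :: (real ^ 'n \<Rightarrow> 'k) set) (Lp_norm 1) (weak_Lp (1 / (1 - \<beta>))) (weak_Lp_norm (1 / (1 - \<beta>)))"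
      by (rule I_tilde(2))
         (simp_all add: frac_int_tilde_def frac_defined_tilde_def frac_integrand_tilde_def[abs_def] dist_norm)
  qed
qed

end
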